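(* The family $(f_{p,q})_{p,q\in\mathbb{N}_0}$ is a Schauder basis of $\mathcal{H}(\Omega)$. In particular, each $f\in\mathcal{H}(\Omega)$ has a unique representation as $$f(z,w)=\sum_{p,q=0}^{\infty}a_{p,q}f_{p,q}(z,w).$$ This series converges absolutely and locally uniformly in $\Omega$, and the Schauder coefficients $a_{p,q}$ of $f$ are given by $$a_{p,q}=\begin{cases}\displaystyle-\frac{1}{4\pi^2}\int_{\partial\mathbb{D}}\int_{\partial\mathbb{D}}f\Big(z,\frac{w}{1+zw}\Big)\frac{dz\,dw}{z^{p+1}w^{q+1}} & \text{if } p<q,\\[3mm]\displaystyle-\frac{1}{4\pi^2}\int_{\partial\mathbb{D}}\int_{\partial\mathbb{D}}f\Big(\frac{z}{1+zw},w\Big)\frac{dz\,dw}{z^{p+1}w^{q+1}} & \text{if } p\ge q.\end{cases}$$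
   Context: $\hat{\mathbb{C}}=\mathbb{C}\cup\{\infty\}$ is the Riemann sphere, with conventions $z\cdot\infty=\infty\cdot z=\infty$ for $z\in\hat{\mathbb{C}}\setminus\{0\}$ and $0\cdot\infty=\infty\cdot 0=1$. $\Omega:=\{(z,w)\in\hat{\mathbb{C}}^2: z\cdot w\neq 1\}$, an open subset of $\hat{\mathbb{C}}^2$ and hence a complex manifold of dimension 2. $\mathcal{H}(\Omega)$ is the Fréchet space of holomorphic functions $\Omega\to\mathbb{C}$ with the topology of locally uniform convergence. For $p,q\in\mathbb{N}_0$, $f_{p,q}:\Omega\to\mathbb{C}$ is the holomorphic function given by $f_{p,q}(z,w)=\dfrac{z^pw^q}{(1-zw)^{\max\{p,q\}}}$ on $\Omega\cap\mathbb{C}^2$ and extended holomorphically to all of $\Omega$. $\partial\mathbb{D}$ is the positively oriented unit circle. For $z,w\in\partial\mathbb{D}$ with $1+zw=0$ the expressions $\frac{w}{1+zw}$ and $\frac{z}{1+zw}$ equal $\infty\in\hat{\mathbb{C}}$; the points $(z,\frac{w}{1+zw})$ and $(\frac{z}{1+zw},w)$ always lie in $\Omega$. *)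

theory Defs
  imports "HOL-Complex_Analysis.Complex_Analysis"
begin

section \<open>The Riemann sphere and the domain\<close>

text \<open>The point at infinity is \<^term>\<open>None\<close>.\<close>

type_synonym sphere = "complex option"

definition sphere_top :: "sphere topology" where
  "sphere_top = Alexandroff_compactification euclidean"

definition sphere2_top :: "(sphere \<times> sphere) topology" where
  "sphere2_top = prod_topology sphere_top sphere_top"

text \<open>Multiplication with the convention that zero times infinity is \<^emph>\<open>one\<close>.\<close>

fun sphere_mult :: "sphere \<Rightarrow> sphere \<Rightarrow> sphere" where
  "sphere_mult (Some z) (Some w) = Some (z * w)"
| "sphere_mult None (Some w) = (if w = 0 then Some 1 else None)"
| "sphere_mult (Some z) None = (if z = 0 then Some 1 else None)"
| "sphere_mult None None = None"

text \<open>Only used with \<open>a \<noteq> 0\<close>.\<close>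

definition sphere_divide :: "complex \<Rightarrow> complex \<Rightarrow> sphere" where
  "sphere_divide a b = (if b = 0 then None else Some (a / b))"

definition Omega :: "(sphere \<times> sphere) set" where
  "Omega = {(z, w). sphere_mult z w \<noteq> Some 1}"


section \<open>Holomorphic functions on the domain\<close>

text \<open>Holomorphy in two complex variables on an open set: the real Frechet derivative exists and
  is complex linear.\<close>

definition holomorphic2_on :: "(complex \<times> complex \<Rightarrow> complex) \<Rightarrow> (complex \<times> complex) set \<Rightarrow> bool" where
  "holomorphic2_on f U \<longleftrightarrow>
     (\<forall>x\<in>U. \<exists>a b. (f has_derivative (\<lambda>(h, k). a * h + b * k)) (at x))"

text \<open>The inverses of the two standard charts of the sphere.\<close>

definition sphere_charts :: "(complex \<Rightarrow> sphere) set" where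
  "sphere_charts = {Some, sphere_divide 1}"

text \<open>Functions on \<^term>\<open>Omega\<close> are represented by total functions that vanish off \<^term>\<open>Omega\<close>, so
  that equality of the representing functions is equality on \<^term>\<open>Omega\<close> and the set below
  is a complex vector space under the pointwise operations.\<close>

definition holo_Omega :: "(sphere \<times> sphere \<Rightarrow> complex) set" where
  "holo_Omega = {f. (\<forall>x. x \<notin> Omega \<longrightarrow> f x = 0) \<and>
     (\<forall>\<phi>\<in>sphere_charts. \<forall>\<psi>\<in>sphere_charts.
        holomorphic2_on (f \<circ> map_prod \<phi> \<psi>) {x. map_prod \<phi> \<psi> x \<in> Omega})}"

text \<open>Since \<^term>\<open>Omega\<close> is locally compact, locally uniform convergence is uniform convergence
  on compact subsets.\<close>

definition holo_nbhd ::
  "(sphere \<times> sphere \<Rightarrow> complex) \<Rightarrow> (sphere \<times> sphere) set \<Rightarrow> real \<Rightarrow> (sphere \<times> sphere \<Rightarrow> complex) set" where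
  "holo_nbhd f K \<epsilon> = {g \<in> holo_Omega. \<forall>x\<in>K. cmod (g x - f x) < \<epsilon>}"

definition holo_open :: "(sphere \<times> sphere \<Rightarrow> complex) set \<Rightarrow> bool" where
  "holo_open U \<longleftrightarrow> U \<subseteq> holo_Omega \<and>
     (\<forall>f\<in>U. \<exists>K \<epsilon>. compactin sphere2_top K \<and> K \<subseteq> Omega \<and> \<epsilon> > 0 \<and> holo_nbhd f K \<epsilon> \<subseteq> U)"

definition holo_top :: "(sphere \<times> sphere \<Rightarrow> complex) topology" where
  "holo_top = topology holo_open"

lemma istopology_holo_open: "istopology holo_open"
  unfolding istopology_def
proof (intro conjI allI impI)
  fix S T assume S: "holo_open S" and T: "holo_open T"
  show "holo_open (S \<inter> T)"
    unfolding holo_open_def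
  proof (intro conjI ballI)
    show "S \<inter> T \<subseteq> holo_Omega" using S by (auto simp: holo_open_def)
    fix f assume f: "f \<in> S \<inter> T"
    obtain K d where K: "compactin sphere2_top K" "K \<subseteq> Omega" "d > 0" "holo_nbhd f K d \<subseteq> S"
      using S f unfolding holo_open_def by blast
    obtain L e where L: "compactin sphere2_top L" "L \<subseteq> Omega" "e > 0" "holo_nbhd f L e \<subseteq> T"
      using T f unfolding holo_open_def by blast
    have "holo_nbhd f (K \<union> L) (min d e) \<subseteq> holo_nbhd f K d \<inter> holo_nbhd f L e"
      by (auto simp: holo_nbhd_def)
    then have "holo_nbhd f (K \<union> L) (min d e) \<subseteq> S \<inter> T"
      using K(4) L(4) by blast
    moreover have "compactin sphere2_top (K \<union> L)"
      using K(1) L(1) by (rule compactin_Un)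
    ultimately show "\<exists>K \<epsilon>. compactin sphere2_top K \<and> K \<subseteq> Omega \<and> \<epsilon> > 0 \<and> holo_nbhd f K \<epsilon> \<subseteq> S \<inter> T"
      using K(2,3) L(2,3) by (intro exI[of _ "K \<union> L"] exI[of _ "min d e"]) auto
  qed
next
  fix \<U> assume U: "\<forall>S\<in>\<U>. holo_open S"
  show "holo_open (\<Union>\<U>)"
    unfolding holo_open_def
  proof (intro conjI ballI)
    show "\<Union>\<U> \<subseteq> holo_Omega" using U by (auto simp: holo_open_def)
    fix f assume "f \<in> \<Union>\<U>"
    then obtain S where S: "S \<in> \<U>" "f \<in> S" by blast
    then obtain K d where "compactin sphere2_top K" "K \<subseteq> Omega" "d > 0" "holo_nbhd f K d \<subseteq> S"
      using U unfolding holo_open_def by meson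
    then show "\<exists>K \<epsilon>. compactin sphere2_top K \<and> K \<subseteq> Omega \<and> \<epsilon> > 0 \<and> holo_nbhd f K \<epsilon> \<subseteq> \<Union>\<U>"
      using S(1) by blast
  qed
qed

lemma openin_holo_top: "openin holo_top U \<longleftrightarrow> holo_open U"
  by (simp add: holo_top_def istopology_holo_open)

lemma topspace_holo_top: "topspace holo_top = holo_Omega"
proof -
  have "holo_open holo_Omega"
    unfolding holo_open_def
    by (auto simp: holo_nbhd_def intro!: exI[of _ "{}"] exI[of _ "1::real"])
  then show ?thesis
    unfolding topspace_def openin_holo_top by (auto simp: holo_open_def)
qed


section \<open>Schauder bases of topological vector spaces of complex functions\<close>

definition expands :: "('x \<Rightarrow> complex) topology \<Rightarrow> (nat \<Rightarrow> 'x \<Rightarrow> complex) \<Rightarrow> ('x \<Rightarrow> complex) \<Rightarrow> (nat \<Rightarrow> complex) \<Rightarrow> bool" where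
  "expands T e f a \<longleftrightarrow> limitin T (\<lambda>N x. \<Sum>n<N. a n * e n x) f sequentially"

text \<open>Only meaningful when the expansion exists and is unique.\<close>

definition schauder_coeff :: "('x \<Rightarrow> complex) topology \<Rightarrow> (nat \<Rightarrow> 'x \<Rightarrow> complex) \<Rightarrow> ('x \<Rightarrow> complex) \<Rightarrow> nat \<Rightarrow> complex" where
  "schauder_coeff T e f = (THE a. expands T e f a)"

text \<open>Continuity of the coefficient functionals, automatic in Frechet spaces, is part of
  the definition.\<close>

definition schauder_basis :: "('x \<Rightarrow> complex) topology \<Rightarrow> (nat \<Rightarrow> 'x \<Rightarrow> complex) \<Rightarrow> bool" where
  "schauder_basis T e \<longleftrightarrow>
     (\<forall>n. e n \<in> topspace T) \<and>
     (\<forall>f\<in>topspace T. \<exists>!a. expands T e f a) \<and>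
     (\<forall>n. continuous_map T euclidean (\<lambda>f. schauder_coeff T e f n))"


section \<open>The basis functions and the coefficient integrals\<close>

text \<open>The holomorphic extension is unique because the finite points are dense in \<^term>\<open>Omega\<close>.
  It exists because in each pair of charts the given formula extends; for instance, at the points
  (infinity, w) with \<open>w \<noteq> 0\<close> finite, its value is \<open>(-1)^p * w^q / w^p\<close> if \<open>q \<le> p\<close>,
  and zero otherwise.\<close>

definition f_pq :: "nat \<Rightarrow> nat \<Rightarrow> sphere \<times> sphere \<Rightarrow> complex" where
  "f_pq p q = (THE g. g \<in> holo_Omega \<and>
     (\<forall>z w. (Some z, Some w) \<in> Omega \<longrightarrow> g (Some z, Some w) = z ^ p * w ^ q / (1 - z * w) ^ max p q))"

definition coeff_integral :: "(sphere \<times> sphere \<Rightarrow> complex) \<Rightarrow> nat \<Rightarrow> nat \<Rightarrow> complex" where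
  "coeff_integral f p q =
    (if p < q then
       - (1 / (4 * of_real pi ^ 2)) *
       contour_integral (circlepath 0 1) (\<lambda>w. contour_integral (circlepath 0 1)
         (\<lambda>z. f (Some z, sphere_divide w (1 + z * w)) / (z ^ (p + 1) * w ^ (q + 1))))
     else
       - (1 / (4 * of_real pi ^ 2)) *
       contour_integral (circlepath 0 1) (\<lambda>w. contour_integral (circlepath 0 1)
         (\<lambda>z. f (sphere_divide z (1 + z * w), Some w) / (z ^ (p + 1) * w ^ (q + 1)))))"

end

theory Submission
  imports Defs
begin

text \<open>
  Put \<open>A = z / (1 - z w)\<close>, \<open>B = w / (1 - z w)\<close> and \<open>C = z w / (1 - z w)\<close>. These three functions extend
  holomorphically to the domain, and the function \<open>f_pq p q\<close> is the monomial \<open>C ^ q * A ^ (p - q)\<close> for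
  \<open>p \<ge> q\<close> and \<open>C ^ p * B ^ (q - p)\<close> for \<open>p < q\<close>. On a set where \<open>A\<close>, \<open>B\<close>, \<open>C\<close> are bounded by
  \<open>M \<ge> 1\<close> it is therefore bounded by \<open>M ^ (p + q)\<close>, so a series \<open>\<Sum> a p q * f_pq p q\<close> converges
  absolutely and locally uniformly as soon as \<open>a p q\<close> decays faster than every geometric sequence
  (\<open>rapid\<close>).

  The maps \<open>(z, w) \<mapsto> (z, w / (1 + z w))\<close> and \<open>(z, w) \<mapsto> (z / (1 + z w), w)\<close> send all of
  \<open>\<complex> \<times> \<complex>\<close> holomorphically into the domain. A holomorphic function \<open>f\<close> on the domain thus pulls back
  to two entire functions \<open>F\<close> and \<open>G\<close>, and the coefficient integrals are Taylor coefficients: those of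
  \<open>F\<close> for \<open>p < q\<close>, those of \<open>G\<close> for \<open>p \<ge> q\<close>. Cauchy's estimates on large tori make them \<open>rapid\<close>.
  Under the first map \<open>f_pq p q\<close> becomes \<open>z ^ p * w ^ q * (1 + z w) ^ (p - q)\<close>, with the exponent
  \<open>p - q\<close> cut off at zero. For \<open>p \<le> q\<close> this is a single monomial; for \<open>p > q\<close> it only contains monomials
  whose exponent of \<open>z\<close> exceeds that of \<open>w\<close>. Together with the mirror image of this fact for the second map
  it shows that the coefficient functionals are biorthogonal to the functions \<open>f_pq p q\<close>
  (\<open>coeff_integral_f_pq\<close>). They are also continuous (\<open>continuous_map_coeff_integral\<close>), being
  integrals over compact images of the unit torus in the domain, and uniqueness of the coefficients follows for every mode of
  convergence at hand (\<open>coeff_unique_of_limit\<close>).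

  It remains to see that the series represents \<open>f\<close>. At a finite point the two Taylor series give
  \<open>f (z, w) = \<Sum> c p q * z ^ p * (w / (1 - z w)) ^ q = \<Sum> e p q * (z / (1 - z w)) ^ p * w ^ q\<close>.
  Both are valid at all the points \<open>(t z, w / t)\<close> with \<open>\<bar>t\<bar> = 1\<close>, where they become Fourier series in
  \<open>t\<close> in which the term with index \<open>(p, q)\<close> has frequency \<open>p - q\<close>. Hence they agree frequency by frequency,
  and the part of the first series with \<open>p \<ge> q\<close> may be exchanged for that of the second
  (\<open>fourier_nonneg_part\<close>). The result is exactly the series of the \<open>f_pq p q\<close>
  (\<open>finite_expansion\<close>). Finite points are dense and everything is continuous, so the expansion holds on the
  whole domain (\<open>expansion\<close>).
\<close>

section \<open>Entire functions of two variables and their coefficients on the unit torus\<close>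

text \<open>Separate holomorphy with joint continuity: exactly what Cauchy's formula in each variable and the
  interchange of the two integrals require.\<close>

definition entire2 :: "(complex \<Rightarrow> complex \<Rightarrow> complex) \<Rightarrow> bool" where
  "entire2 F \<longleftrightarrow> continuous_on UNIV (\<lambda>(z, w). F z w) \<and>
     (\<forall>w. (\<lambda>z. F z w) holomorphic_on UNIV) \<and> (\<forall>z. F z holomorphic_on UNIV)"

text \<open>The Taylor coefficient of index \<open>(p, q)\<close> at the origin when \<open>F\<close> is entire, but meaningful for any
  function continuous on the unit torus. The constant is \<open>1 / (2 * pi * \<i>)\<^sup>2\<close>.\<close>

definition torus_coeff :: "(complex \<Rightarrow> complex \<Rightarrow> complex) \<Rightarrow> nat \<Rightarrow> nat \<Rightarrow> complex" where
  "torus_coeff F p q = - (1 / (4 * of_real pi ^ 2)) *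
     contour_integral (circlepath 0 1) (\<lambda>w. contour_integral (circlepath 0 1)
       (\<lambda>z. F z w / (z ^ (p + 1) * w ^ (q + 1))))"

lemma continuous_on_contour_integral_circlepath:
  fixes f :: "'a::topological_space \<Rightarrow> complex \<Rightarrow> complex"
  assumes "continuous_on (S \<times> sphere c r) (\<lambda>(w, z). f w z)" "r \<ge> 0"
  shows "continuous_on S (\<lambda>w. contour_integral (circlepath c r) (f w))"
proof -
  let ?g = "circlepath c r"
  have g: "continuous_on UNIV ?g"
    unfolding circlepath by (intro continuous_intros)
  have gS: "dist c (?g t) = r" for t
    using assms(2) by (auto simp: circlepath dist_norm norm_mult)
  have "continuous_on (S \<times> cbox 0 1) (\<lambda>(w, t). f w (?g t) * vector_derivative ?g (at t))"
  proof -
    have "continuous_on (S \<times> cbox 0 1) (\<lambda>x. (\<lambda>(w, z). f w z) (fst x, ?g (snd x)))"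
      by (rule continuous_on_compose2[OF assms(1)])
        (auto intro!: continuous_intros continuous_on_compose2[OF g] simp: gS)
    then show ?thesis
      unfolding vector_derivative_circlepath case_prod_unfold
      by (intro continuous_intros) (auto simp: case_prod_unfold)
  qed
  then have "continuous_on S (\<lambda>w. integral (cbox 0 1) (\<lambda>t. f w (?g t) * vector_derivative ?g (at t)))"
    by (rule integral_continuous_on_param)
  then show ?thesis
    by (simp add: contour_integral_integral)
qed

lemma entire_contour_integral_coeff:
  assumes "f holomorphic_on UNIV" "R > 0"
  shows "contour_integral (circlepath 0 R) (\<lambda>z. f z / z ^ (p + 1)) = 2 * pi * \<i> * ((deriv ^^ p) f 0 / fact p)"
  using Cauchy_contour_integral_circlepath[of 0 R f 0 p] assms
  by (auto intro: holomorphic_on_subset holomorphic_on_imp_continuous_on)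

text \<open>The coefficient of \<open>z ^ p\<close> in the power series of \<open>F\<close> in its first variable alone, as a function of
  the second variable.\<close>

definition part_coeff :: "(complex \<Rightarrow> complex \<Rightarrow> complex) \<Rightarrow> nat \<Rightarrow> complex \<Rightarrow> complex" where
  "part_coeff F p w = (deriv ^^ p) (\<lambda>z. F z w) 0 / fact p"

lemma entire2_continuous_on_compose:
  assumes "entire2 F" "continuous_on S f" "continuous_on S g"
  shows "continuous_on S (\<lambda>x. F (f x) (g x))"
  using continuous_on_compose2[of UNIV "\<lambda>(z, w). F z w" S "\<lambda>x. (f x, g x)"] assms
  by (auto simp: entire2_def intro!: continuous_intros)

text \<open>On any disc, \<open>F\<close> is a Cauchy integral in its second variable. Integrating this against
  \<open>1 / z ^ (p + 1)\<close> and interchanging the integrals exhibits the coefficient as the Cauchy integral of its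
  own continuous boundary values, hence as a holomorphic function.\<close>

lemma holomorphic_part_coeff:
  assumes F: "entire2 F"
  shows "part_coeff F p holomorphic_on UNIV"
proof -
  define g where "g = (\<lambda>w. contour_integral (circlepath 0 1) (\<lambda>z. F z w / z ^ (p + 1)))"
  have g: "g w = 2 * pi * \<i> * part_coeff F p w" for w
    using F unfolding g_def part_coeff_def entire2_def
    by (intro entire_contour_integral_coeff) auto
  have cont_g: "continuous_on S g" for S
    unfolding g_def
    by (rule continuous_on_contour_integral_circlepath)
      (auto simp: case_prod_unfold intro!: continuous_intros entire2_continuous_on_compose[OF F])
  have "g field_differentiable (at w)" for w
  proof -
    \<comment> \<open>Any circle around the origin that encloses \<open>w\<close>.\<close>
    define r where "r = norm w + 1"
    have r: "r > 0" "w \<in> ball 0 r" by (auto simp: r_def add_nonneg_pos)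
    have int: "((\<lambda>v. g v / (v - x) ^ 1) has_contour_integral 2 * pi * \<i> * g x) (circlepath 0 r)"
      if x: "x \<in> ball 0 r" for x
    proof -
      have ne: "v \<noteq> x" if "norm v = r" for v using that x by auto
      have "2 * pi * \<i> * g x = contour_integral (circlepath 0 1) (\<lambda>z. 2 * pi * \<i> * (F z x / z ^ (p + 1)))"
        unfolding g_def
        by (intro contour_integral_lmul[symmetric] contour_integrable_continuous_circlepath)
          (auto intro!: continuous_intros entire2_continuous_on_compose[OF F])
      also have "\<dots> = contour_integral (circlepath 0 1)
           (\<lambda>z. contour_integral (circlepath 0 r) (\<lambda>v. F z v / (v - x) / z ^ (p + 1)))"
      proof (rule contour_integral_eq)
        fix z :: complex assume z: "z \<in> path_image (circlepath 0 1)"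
        have "((\<lambda>v. F z v / (v - x)) has_contour_integral 2 * of_real pi * \<i> * F z x) (circlepath 0 r)"
          using F x unfolding entire2_def
          by (intro Cauchy_integral_circlepath)
            (auto intro: holomorphic_on_subset holomorphic_on_imp_continuous_on)
        then have "((\<lambda>v. F z v / (v - x) / z ^ (p + 1)) has_contour_integral 2 * of_real pi * \<i> * F z x / z ^ (p + 1)) (circlepath 0 r)"
          by (rule has_contour_integral_div)
        then show "2 * pi * \<i> * (F z x / z ^ (p + 1)) = contour_integral (circlepath 0 r) (\<lambda>v. F z v / (v - x) / z ^ (p + 1))"
          by (simp add: contour_integral_unique)
      qed
      also have "\<dots> = contour_integral (circlepath 0 r)
           (\<lambda>v. contour_integral (circlepath 0 1) (\<lambda>z. F z v / (v - x) / z ^ (p + 1)))"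
        using r(1) ne
        by (intro contour_integral_swap)
          (auto simp: case_prod_unfold vector_derivative_circlepath intro!: continuous_intros entire2_continuous_on_compose[OF F])
      also have "\<dots> = contour_integral (circlepath 0 r) (\<lambda>v. g v / (v - x))"
      proof (rule contour_integral_eq)
        fix v :: complex
        have "contour_integral (circlepath 0 1) (\<lambda>z. F z v / z ^ (p + 1) / (v - x)) = g v / (v - x)"
          unfolding g_def
          by (intro contour_integral_div contour_integrable_continuous_circlepath)
            (auto intro!: continuous_intros entire2_continuous_on_compose[OF F])
        then show "contour_integral (circlepath 0 1) (\<lambda>z. F z v / (v - x) / z ^ (p + 1)) = g v / (v - x)"
          by (simp add: mult_ac)
      qed
      finally have "2 * pi * \<i> * g x = contour_integral (circlepath 0 r) (\<lambda>v. g v / (v - x))" .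
      moreover have "(\<lambda>v. g v / (v - x)) contour_integrable_on circlepath 0 r"
        using r(1) ne
        by (intro contour_integrable_continuous_circlepath continuous_intros cont_g) auto
      ultimately show ?thesis
        using has_contour_integral_integral by force
    qed
    from Cauchy_next_derivative_circlepath(2)[OF cont_g int _ r(2)]
    have "(\<lambda>w. 2 * pi * \<i> * g w) field_differentiable (at w)"
      unfolding field_differentiable_def by fastforce
    then have "(\<lambda>w. 1 / (2 * pi * \<i>) * (2 * pi * \<i> * g w)) field_differentiable (at w)"
      by (rule field_differentiable_mult[OF field_differentiable_const])
    moreover have "(\<lambda>w. 1 / (2 * pi * \<i>) * (2 * pi * \<i> * g w)) = g"
      by (simp add: fun_eq_iff)
    ultimately show ?thesis by (simp only:)
  qed
  then have "g holomorphic_on UNIV"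
    by (simp add: holomorphic_on_def field_differentiable_at_within)
  then have "(\<lambda>w. 1 / (2 * pi * \<i>) * g w) holomorphic_on UNIV"
    by (intro holomorphic_intros)
  then show ?thesis by (simp add: g)
qed

text \<open>As a double Taylor coefficient, the torus integral does not depend on the radius of the torus; this
  is what permits estimating it on tori of any radius.\<close>

lemma torus_coeff_eq_deriv:
  assumes F: "entire2 F"
  shows "torus_coeff F p q = (deriv ^^ q) (part_coeff F p) 0 / fact q"
proof -
  have "contour_integral (circlepath 0 1) (\<lambda>z. F z w / (z ^ (p + 1) * w ^ (q + 1))) =
      2 * pi * \<i> * (part_coeff F p w / w ^ (q + 1))" for w
  proof -
    have "contour_integral (circlepath 0 1) (\<lambda>z. F z w / z ^ (p + 1) / w ^ (q + 1)) =
        contour_integral (circlepath 0 1) (\<lambda>z. F z w / z ^ (p + 1)) / w ^ (q + 1)"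
      by (intro contour_integral_div contour_integrable_continuous_circlepath)
        (auto intro!: continuous_intros entire2_continuous_on_compose[OF F])
    also have "contour_integral (circlepath 0 1) (\<lambda>z. F z w / z ^ (p + 1)) = 2 * pi * \<i> * part_coeff F p w"
      using F unfolding part_coeff_def entire2_def
      by (intro entire_contour_integral_coeff) auto
    finally show ?thesis by simp
  qed
  moreover have "contour_integral (circlepath 0 1) (\<lambda>w. 2 * pi * \<i> * (part_coeff F p w / w ^ (q + 1))) =
     2 * pi * \<i> * contour_integral (circlepath 0 1) (\<lambda>w. part_coeff F p w / w ^ (q + 1))"
    by (intro contour_integral_lmul contour_integrable_continuous_circlepath continuous_intros
          continuous_on_subset[OF holomorphic_on_imp_continuous_on[OF holomorphic_part_coeff[OF F]]]) auto
  moreover have "contour_integral (circlepath 0 1) (\<lambda>w. part_coeff F p w / w ^ (q + 1)) =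
     2 * pi * \<i> * ((deriv ^^ q) (part_coeff F p) 0 / fact q)"
    by (intro entire_contour_integral_coeff holomorphic_part_coeff F) auto
  ultimately show ?thesis
    by (simp add: torus_coeff_def field_simps power2_eq_square)
qed

lemma torus_coeff_bound:
  assumes F: "entire2 F" and R: "R > 0"
    and B: "\<And>z w. norm z = R \<Longrightarrow> norm w = R \<Longrightarrow> norm (F z w) \<le> B"
  shows "norm (torus_coeff F p q) \<le> B / R ^ (p + q)"
proof -
  have 1: "norm (part_coeff F p w) \<le> B / R ^ p" if "norm w = R" for w
  proof -
    have "norm ((deriv ^^ p) (\<lambda>z. F z w) 0) \<le> fact p * B / R ^ p"
      by (rule Cauchy_inequality)
        (use F R B that in \<open>auto simp: entire2_def intro: holomorphic_on_subset
           intro!: entire2_continuous_on_compose[OF F] continuous_intros\<close>)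
    then show ?thesis
      by (simp add: part_coeff_def norm_divide field_simps)
  qed
  have "norm ((deriv ^^ q) (part_coeff F p) 0) \<le> fact q * (B / R ^ p) / R ^ q"
    by (rule Cauchy_inequality)
      (use R 1 holomorphic_part_coeff[OF F, of p] in \<open>auto intro: holomorphic_on_subset holomorphic_on_imp_continuous_on\<close>)
  then show ?thesis
    by (simp add: torus_coeff_eq_deriv[OF F] norm_divide field_simps power_add)
qed

text \<open>Decay faster than every geometric sequence: the condition that holds for the Taylor coefficients of
  entire functions of two variables and characterises them.\<close>

definition rapid :: "(nat \<Rightarrow> nat \<Rightarrow> complex) \<Rightarrow> bool" where
  "rapid a \<longleftrightarrow> (\<forall>M>0. (\<lambda>(p, q). norm (a p q) * M ^ (p + q)) summable_on UNIV)"

lemma summable_on_geometric2: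
  fixes x :: real
  assumes "0 \<le> x" "x < 1"
  shows "(\<lambda>(p, q). x ^ (p + q)) summable_on (UNIV :: (nat \<times> nat) set)"
proof -
  have g: "((\<lambda>n. x ^ n) has_sum (1 / (1 - x))) UNIV"
    using assms geometric_sums[of x] by (intro sums_nonneg_imp_has_sum) auto
  have "(\<lambda>(p, q). x ^ (p + q)) summable_on (SIGMA p:(UNIV :: nat set). (UNIV :: nat set))"
  proof (rule summable_on_SigmaI)
    show "((\<lambda>q. case (p, q) of (p, q) \<Rightarrow> x ^ (p + q)) has_sum (x ^ p * (1 / (1 - x)))) UNIV" for p
      using has_sum_cmult_right[OF g, of "x ^ p"] by (simp add: power_add)
    show "(\<lambda>p. x ^ p * (1 / (1 - x))) summable_on UNIV"
      using g by (intro summable_on_cmult_left) (auto simp: summable_on_def)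
  qed (use assms in auto)
  then show ?thesis by simp
qed

text \<open>To sum against \<open>M ^ (p + q)\<close>, use Cauchy's estimate on the torus of radius \<open>2 * M\<close>, which leaves
  the convergent double geometric series with ratio one half.\<close>

lemma rapid_torus_coeff:
  assumes F: "entire2 F"
  shows "rapid (torus_coeff F)"
  unfolding rapid_def
proof (intro allI impI)
  fix M :: real assume M: "M > 0"
  have "compact (sphere (0::complex) (2 * M) \<times> sphere (0::complex) (2 * M))"
    by (intro compact_Times compact_sphere)
  then have "bounded ((\<lambda>(z, w). F z w) ` (sphere 0 (2 * M) \<times> sphere 0 (2 * M)))"
    using F unfolding entire2_def
    by (intro compact_imp_bounded compact_continuous_image) (auto intro: continuous_on_subset)
  then obtain B where B: "\<And>z w. norm z = 2 * M \<Longrightarrow> norm w = 2 * M \<Longrightarrow> norm (F z w) \<le> B"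
    unfolding bounded_iff by fastforce
  have "norm (torus_coeff F p q) * M ^ (p + q) \<le> B * (1 / 2) ^ (p + q)" for p q
    using torus_coeff_bound[of F "2 * M" B p q] F B M
    by (simp add: field_simps power_mult_distrib)
  then show "(\<lambda>(p, q). norm (torus_coeff F p q) * M ^ (p + q)) summable_on UNIV"
    using M
    by (intro summable_on_comparison_test[OF summable_on_cmult_right[OF summable_on_geometric2[of "1 / 2"], of B]])
      (auto simp: case_prod_unfold)
qed

lemma rapid_summable:
  assumes "rapid a" "M > 0" "\<And>p q. norm (g p q) \<le> M ^ (p + q)"
  shows "(\<lambda>(p, q). norm (a p q * g p q)) summable_on S"
proof -
  have "(\<lambda>(p, q). norm (a p q * g p q)) summable_on UNIV"
  proof (rule summable_on_comparison_test)
    show "(\<lambda>(p, q). norm (a p q) * M ^ (p + q)) summable_on UNIV"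
      using assms(1,2) unfolding rapid_def by auto
    show "(case x of (p, q) \<Rightarrow> norm (a p q * g p q)) \<le> (case x of (p, q) \<Rightarrow> norm (a p q) * M ^ (p + q))" for x
      using assms(3) by (auto simp: norm_mult split: prod.splits intro!: mult_left_mono)
  qed auto
  then show ?thesis by (rule summable_on_subset_banach) auto
qed

text \<open>The double series is absolutely convergent, so it may be summed first over \<open>q\<close> and then over \<open>p\<close>;
  each of these is a one-variable power series.\<close>

lemma entire2_expansion:
  assumes F: "entire2 F"
  shows "((\<lambda>(p, q). torus_coeff F p q * (z ^ p * w ^ q)) has_sum F z w) UNIV"
proof -
  define M where "M = max (max (norm z) (norm w)) 1"
  have sm: "(\<lambda>(p, q). norm (torus_coeff F p q * (z ^ p * w ^ q))) summable_on UNIV"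
    by (rule rapid_summable[OF rapid_torus_coeff[OF F], of M])
      (auto simp: norm_mult norm_power power_add M_def intro!: mult_mono power_mono)
  then obtain S where S: "((\<lambda>(p, q). torus_coeff F p q * (z ^ p * w ^ q)) has_sum S) UNIV"
    using abs_summable_summable[of "\<lambda>(p, q). torus_coeff F p q * (z ^ p * w ^ q)" UNIV]
    by (auto simp: summable_on_def case_prod_unfold)
  have inner: "((\<lambda>q. torus_coeff F p q * (z ^ p * w ^ q)) has_sum part_coeff F p w * z ^ p) UNIV" for p
  proof -
    have "(\<lambda>q. (deriv ^^ q) (part_coeff F p) 0 / fact q * (w - 0) ^ q) sums part_coeff F p w"
      by (rule holomorphic_power_series[of _ _ "norm w + 1"])
        (auto intro: holomorphic_on_subset[OF holomorphic_part_coeff[OF F]])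
    then have "(\<lambda>q. torus_coeff F p q * w ^ q * z ^ p) sums (part_coeff F p w * z ^ p)"
      by (intro sums_mult2) (simp add: torus_coeff_eq_deriv[OF F])
    moreover have "(\<lambda>q. torus_coeff F p q * (z ^ p * w ^ q)) summable_on UNIV"
      using summable_on_SigmaD1[of "\<lambda>p q. torus_coeff F p q * (z ^ p * w ^ q)" UNIV "\<lambda>_. UNIV" p] S
      by (auto simp: summable_on_def)
    then obtain T where T: "((\<lambda>q. torus_coeff F p q * (z ^ p * w ^ q)) has_sum T) UNIV"
      by (auto simp: summable_on_def)
    ultimately have "T = part_coeff F p w * z ^ p"
      using has_sum_imp_sums[OF T] by (simp add: mult_ac sums_unique2)
    with T show ?thesis by simp
  qed
  have "((\<lambda>p. part_coeff F p w * z ^ p) has_sum S) UNIV"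
  proof (rule has_sum_SigmaD)
    show "((\<lambda>(p, q). torus_coeff F p q * (z ^ p * w ^ q)) has_sum S) (UNIV \<times> UNIV)"
      using S by simp
  qed (simp add: inner)
  moreover have "(\<lambda>p. (deriv ^^ p) (\<lambda>z. F z w) 0 / fact p * (z - 0) ^ p) sums F z w"
    using F unfolding entire2_def
    by (intro holomorphic_power_series[of _ _ "norm z + 1"])
      (auto intro: holomorphic_on_subset)
  ultimately have "S = F z w"
    using has_sum_imp_sums[of "\<lambda>p. part_coeff F p w * z ^ p" S]
    by (auto simp: part_coeff_def intro: sums_unique2)
  with S show ?thesis by simp
qed

lemma contour_integral_circle_monomial:
  "((\<lambda>z. z ^ m / z ^ (n + 1)) has_contour_integral (if m = n then 2 * pi * \<i> else 0)) (circlepath 0 1)"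
proof -
  have "(deriv ^^ n) (\<lambda>w. (w - 0) ^ m) 0 = (if m = n then fact n else (0::complex))"
    by (subst higher_deriv_power) (auto simp: power_0_left pochhammer_fact pochhammer_0_left not_le)
  then show ?thesis
    using Cauchy_has_contour_integral_higher_derivative_circlepath[of 0 1 "\<lambda>z. z ^ m" 0 n]
    by (simp add: continuous_intros holomorphic_intros del: power_Suc split: if_splits)
qed

lemma torus_integrand_integrable:
  assumes "continuous_on (sphere 0 1 \<times> sphere 0 1) (\<lambda>(z, w). F z w)"
  shows "norm w = 1 \<Longrightarrow> (\<lambda>z. F z w / (z ^ (p + 1) * w ^ (q + 1))) contour_integrable_on circlepath 0 1"
    and "(\<lambda>w. contour_integral (circlepath 0 1) (\<lambda>z. F z w / (z ^ (p + 1) * w ^ (q + 1))))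
           contour_integrable_on circlepath 0 1"
proof -
  have F: "continuous_on S (\<lambda>x. F (f x) (g x))"
    if "continuous_on S f" "continuous_on S g" "\<And>x. x \<in> S \<Longrightarrow> norm (f x) = 1" "\<And>x. x \<in> S \<Longrightarrow> norm (g x) = 1"
    for S :: "'a::topological_space set" and f g
  proof -
    have "continuous_on S (\<lambda>x. (\<lambda>(z, w). F z w) (f x, g x))"
      by (rule continuous_on_compose2[OF assms]) (use that in \<open>auto intro!: continuous_intros\<close>)
    then show ?thesis by simp
  qed
  show "(\<lambda>z. F z w / (z ^ (p + 1) * w ^ (q + 1))) contour_integrable_on circlepath 0 1" if "norm w = 1"
    using that by (intro contour_integrable_continuous_circlepath) (auto intro!: continuous_intros F)
  show "(\<lambda>w. contour_integral (circlepath 0 1) (\<lambda>z. F z w / (z ^ (p + 1) * w ^ (q + 1))))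
           contour_integrable_on circlepath 0 1"
    by (intro contour_integrable_continuous_circlepath continuous_on_contour_integral_circlepath)
      (auto simp: case_prod_unfold intro!: continuous_intros F)
qed

lemma torus_coeff_sum:
  assumes "\<And>i. i \<in> I \<Longrightarrow> continuous_on (sphere 0 1 \<times> sphere 0 1) (\<lambda>(z, w). F i z w)" "finite I"
  shows "torus_coeff (\<lambda>z w. \<Sum>i\<in>I. k i * F i z w) p q = (\<Sum>i\<in>I. k i * torus_coeff (F i) p q)"
proof -
  let ?D = "\<lambda>z w. z ^ (p + 1) * w ^ (q + 1) :: complex"
  let ?J = "\<lambda>i w. contour_integral (circlepath 0 1) (\<lambda>z. F i z w / ?D z w)"
  note int = torus_integrand_integrable[OF assms(1), where p = p and q = q]
  have "contour_integral (circlepath 0 1) (\<lambda>z. (\<Sum>i\<in>I. k i * F i z w) / ?D z w) = (\<Sum>i\<in>I. k i * ?J i w)"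
    if "norm w = 1" for w
  proof -
    have "((\<lambda>z. \<Sum>i\<in>I. k i * (F i z w / ?D z w)) has_contour_integral (\<Sum>i\<in>I. k i * ?J i w)) (circlepath 0 1)"
      by (intro has_contour_integral_sum has_contour_integral_lmul has_contour_integral_integral int that assms(2))
    then show ?thesis
      by (simp add: contour_integral_unique sum_divide_distrib)
  qed
  then have "torus_coeff (\<lambda>z w. \<Sum>i\<in>I. k i * F i z w) p q =
     - (1 / (4 * of_real pi ^ 2)) * contour_integral (circlepath 0 1) (\<lambda>w. \<Sum>i\<in>I. k i * ?J i w)"
    unfolding torus_coeff_def by (intro arg_cong[where f = "\<lambda>x. _ * x"] contour_integral_eq) auto
  also have "contour_integral (circlepath 0 1) (\<lambda>w. \<Sum>i\<in>I. k i * ?J i w) =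
     (\<Sum>i\<in>I. k i * contour_integral (circlepath 0 1) (?J i))"
    by (intro contour_integral_unique has_contour_integral_sum has_contour_integral_lmul has_contour_integral_integral int assms(2))
  finally show ?thesis
    by (simp add: torus_coeff_def sum_distrib_left mult_ac)
qed

text \<open>The length \<open>2 * pi\<close> of the circle, used twice, cancels the normalising constant.\<close>

lemma torus_coeff_diff_bound:
  assumes F: "continuous_on (sphere 0 1 \<times> sphere 0 1) (\<lambda>(z, w). F z w)"
    and G: "continuous_on (sphere 0 1 \<times> sphere 0 1) (\<lambda>(z, w). G z w)"
    and e: "\<And>z w. norm z = 1 \<Longrightarrow> norm w = 1 \<Longrightarrow> norm (F z w - G z w) \<le> e"
  shows "norm (torus_coeff F p q - torus_coeff G p q) \<le> e"
proof -
  let ?D = "\<lambda>z w. z ^ (p + 1) * w ^ (q + 1) :: complex"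
  let ?J = "\<lambda>F w. contour_integral (circlepath 0 1) (\<lambda>z. F z w / ?D z w)"
  have e0: "e \<ge> 0" using order_trans[OF norm_ge_zero e[of 1 1]] by simp
  have 1: "norm (?J F w - ?J G w) \<le> e * (2 * pi * 1)" if w: "norm w = 1" for w
  proof (rule has_contour_integral_bound_circlepath)
    show "((\<lambda>z. F z w / ?D z w - G z w / ?D z w) has_contour_integral ?J F w - ?J G w) (circlepath 0 1)"
      by (intro has_contour_integral_diff has_contour_integral_integral torus_integrand_integrable F G w)
    fix z :: complex assume "norm (z - 0) = 1"
    then show "norm (F z w / ?D z w - G z w / ?D z w) \<le> e"
      using e[of z w] w by (simp add: diff_divide_distrib[symmetric] norm_divide norm_mult norm_power)
  qed (use e0 in auto)
  have "norm (contour_integral (circlepath 0 1) (?J F) - contour_integral (circlepath 0 1) (?J G)) \<le> e * (2 * pi * 1) * (2 * pi * 1)"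
  proof (rule has_contour_integral_bound_circlepath)
    show "((\<lambda>w. ?J F w - ?J G w) has_contour_integral
        contour_integral (circlepath 0 1) (?J F) - contour_integral (circlepath 0 1) (?J G)) (circlepath 0 1)"
      by (intro has_contour_integral_diff has_contour_integral_integral torus_integrand_integrable F G)
  qed (use e0 1 in auto)
  moreover have "torus_coeff F p q - torus_coeff G p q = - (1 / (4 * of_real pi ^ 2)) *
     (contour_integral (circlepath 0 1) (?J F) - contour_integral (circlepath 0 1) (?J G))"
    by (simp add: torus_coeff_def algebra_simps)
  then have "norm (torus_coeff F p q - torus_coeff G p q) = 1 / (4 * pi ^ 2) *
     norm (contour_integral (circlepath 0 1) (?J F) - contour_integral (circlepath 0 1) (?J G))"
    by (simp add: norm_mult norm_divide norm_power)
  ultimately have "norm (torus_coeff F p q - torus_coeff G p q) \<le> 1 / (4 * pi ^ 2) * (e * (2 * pi * 1) * (2 * pi * 1))"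
    using mult_left_mono by (metis (no_types, lifting) divide_nonneg_nonneg mult_nonneg_nonneg zero_le_numeral zero_le_one zero_le_power2)
  then show ?thesis
    by (simp add: power2_eq_square)
qed

lemma torus_coeff_monomial: "torus_coeff (\<lambda>z w. z ^ m * w ^ n) p q = (if m = p \<and> n = q then 1 else 0)"
proof -
  have "contour_integral (circlepath 0 1) (\<lambda>z. z ^ m * w ^ n / (z ^ (p + 1) * w ^ (q + 1))) =
     (w ^ n / w ^ (q + 1)) * (if m = p then 2 * pi * \<i> else 0)" for w :: complex
    using has_contour_integral_lmul[OF contour_integral_circle_monomial[of m p], of "w ^ n / w ^ (q + 1)"]
    by (intro contour_integral_unique) (simp add: mult_ac)
  moreover have "contour_integral (circlepath 0 1) (\<lambda>w. (w ^ n / w ^ (q + 1)) * (if m = p then 2 * pi * \<i> else 0)) =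
     (if n = q then 2 * pi * \<i> else 0) * (if m = p then 2 * pi * \<i> else 0)"
    by (intro contour_integral_unique has_contour_integral_rmul contour_integral_circle_monomial)
  ultimately show ?thesis
    by (simp add: torus_coeff_def power2_eq_square)
qed

section \<open>Fourier series on the unit circle\<close>

text \<open>The term of index \<open>(p, q)\<close> oscillates with frequency \<open>p - q\<close>. Integration against
  \<open>1 / t ^ (d + 1)\<close> isolates the frequency \<open>d\<close>, so each diagonal \<open>p = q + d\<close> sums to zero, and summing over
  all \<open>d \<ge> 0\<close> gives the half-plane \<open>p \<ge> q\<close>.\<close>

lemma fourier_nonneg_part:
  fixes D :: "nat \<Rightarrow> nat \<Rightarrow> complex"
  assumes abs: "(\<lambda>(p, q). norm (D p q)) summable_on UNIV"
    and zero: "\<And>t. norm t = 1 \<Longrightarrow> ((\<lambda>(p, q). D p q * (t ^ p / t ^ q)) has_sum 0) UNIV"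
  shows "((\<lambda>(p, q). D p q) has_sum 0) {(p, q). p \<ge> q}"
proof -
  have diag: "((\<lambda>q. D (q + d) q) has_sum 0) UNIV" for d
  proof -
    have ul: "uniform_limit (sphere 0 1) (\<lambda>X t. \<Sum>(p, q)\<in>X. D p q * (t ^ p / t ^ (q + d + 1)))
        (\<lambda>t. 0) (finite_subsets_at_top UNIV)"
      unfolding case_prod_unfold
    proof (rule Weierstrass_m_test_general')
      show "(\<lambda>x. norm (case x of (p, q) \<Rightarrow> D p q)) summable_on UNIV"
        using abs by (simp add: case_prod_unfold)
      show "norm (D (fst x) (snd x) * (t ^ fst x / t ^ (snd x + d + 1))) \<le> norm (case x of (p, q) \<Rightarrow> D p q)"
        if "t \<in> sphere 0 1" for x t
        using that by (auto simp: norm_mult norm_divide norm_power case_prod_unfold)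
      show "((\<lambda>x. D (fst x) (snd x) * (t ^ fst x / t ^ (snd x + d + 1))) has_sum 0) UNIV"
        if "t \<in> sphere 0 1" for t
        using has_sum_cmult_left[OF zero[of t], of "1 / t ^ (d + 1)"] that
        by (simp add: case_prod_unfold power_add mult_ac)
    qed
    have "((\<lambda>X. contour_integral (circlepath 0 1) (\<lambda>t. \<Sum>(p, q)\<in>X. D p q * (t ^ p / t ^ (q + d + 1)))) \<longlongrightarrow>
        contour_integral (circlepath 0 1) (\<lambda>t. 0)) (finite_subsets_at_top UNIV)"
      by (rule contour_integral_uniform_limit_circlepath(2)[OF _ ul])
        (auto simp: case_prod_unfold intro!: always_eventually contour_integrable_continuous_circlepath continuous_intros)
    moreover have "contour_integral (circlepath 0 1) (\<lambda>t. \<Sum>(p, q)\<in>X. D p q * (t ^ p / t ^ (q + d + 1))) =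
        (\<Sum>(p, q)\<in>X. D p q * (if p = q + d then 2 * pi * \<i> else 0))" if "finite X" for X
      unfolding case_prod_unfold
      by (intro contour_integral_unique has_contour_integral_sum has_contour_integral_lmul contour_integral_circle_monomial that)
    then have "\<forall>\<^sub>F X in finite_subsets_at_top UNIV.
        contour_integral (circlepath 0 1) (\<lambda>t. \<Sum>(p, q)\<in>X. D p q * (t ^ p / t ^ (q + d + 1))) =
        (\<Sum>(p, q)\<in>X. D p q * (if p = q + d then 2 * pi * \<i> else 0))"
      by (simp add: eventually_finite_subsets_at_top_weakI)
    ultimately have "((\<lambda>(p, q). D p q * (if p = q + d then 2 * pi * \<i> else 0)) has_sum 0) UNIV"
      unfolding has_sum_def using tendsto_cong by force
    from has_sum_cmult_left[OF this, of "1 / (2 * pi * \<i>)"]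
    have "((\<lambda>x. (case x of (p, q) \<Rightarrow> D p q * (if p = q + d then 2 * pi * \<i> else 0)) * (1 / (2 * pi * \<i>))) has_sum 0) UNIV"
      by simp
    also have "(\<lambda>x. (case x of (p, q) \<Rightarrow> D p q * (if p = q + d then 2 * pi * \<i> else 0)) * (1 / (2 * pi * \<i>))) =
        (\<lambda>(p, q). D p q * (if p = q + d then 1 else 0))"
      by (auto simp: fun_eq_iff)
    finally have "((\<lambda>(p, q). D p q * (if p = q + d then 1 else 0)) has_sum 0) UNIV" .
    then have "((\<lambda>(p, q). D p q) has_sum 0) (range (\<lambda>q. (q + d, q)))"
      by (subst (asm) has_sum_cong_neutral[where T = "range (\<lambda>q. (q + d, q))" and g = "\<lambda>(p, q). D p q"]) auto
    then show ?thesis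
      by (subst (asm) has_sum_reindex) (auto simp: inj_on_def o_def)
  qed
  have bij: "bij_betw (\<lambda>(d, q). (q + d, q)) (UNIV :: (nat \<times> nat) set) {(p, q). p \<ge> q}"
    by (rule bij_betw_byWitness[where f' = "\<lambda>(p, q). (p - q, q)"]) auto
  have "(\<lambda>x. norm (case x of (p, q) \<Rightarrow> D p q)) summable_on UNIV"
    using abs by (simp add: case_prod_unfold)
  from abs_summable_summable[OF this]
  have "(\<lambda>(p, q). D p q) summable_on {(p, q). p \<ge> q}"
    by (rule summable_on_subset_banach) simp
  then obtain S where S: "((\<lambda>(p, q). D p q) has_sum S) {(p, q). p \<ge> q}"
    unfolding summable_on_def by blast
  have "((\<lambda>x. case (case x of (d, q) \<Rightarrow> (q + d, q)) of (p, q) \<Rightarrow> D p q) has_sum S) UNIV"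
    using has_sum_reindex_bij_betw[OF bij] S by blast
  then have "((\<lambda>(d, q). D (q + d) q) has_sum S) (UNIV \<times> UNIV)"
    by (simp add: case_prod_unfold)
  then have "((\<lambda>d. 0) has_sum S) (UNIV :: nat set)"
    by (rule has_sum_SigmaD) (simp add: diag)
  then have "S = 0"
    by (rule has_sum_unique) simp
  with S show ?thesis by simp
qed

section \<open>Complex differentiability in two variables\<close>

text \<open>The pointwise form of \<^const>\<open>holomorphic2_on\<close>.\<close>

definition cdiff2 :: "(complex \<times> complex \<Rightarrow> complex) \<Rightarrow> complex \<times> complex \<Rightarrow> bool" where
  "cdiff2 f x \<longleftrightarrow> (\<exists>a b. (f has_derivative (\<lambda>(h, k). a * h + b * k)) (at x))"

lemma holomorphic2_on_cdiff2: "holomorphic2_on f U \<longleftrightarrow> (\<forall>x\<in>U. cdiff2 f x)"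
  by (simp add: holomorphic2_on_def cdiff2_def)

lemma cdiff2I:
  assumes "(f has_derivative f') (at x)" "\<And>h k. f' (h, k) = a * h + b * k"
  shows "cdiff2 f x"
proof -
  have "f' = (\<lambda>(h, k). a * h + b * k)" using assms(2) by auto
  with assms(1) show ?thesis unfolding cdiff2_def by auto
qed

text \<open>Complex differentiability is local, so a function may be replaced by a formula valid near the point.\<close>

lemma cdiff2_cong:
  assumes "cdiff2 f x" "open D" "x \<in> D" "\<And>y. y \<in> D \<Longrightarrow> f y = g y"
  shows "cdiff2 g x"
  using assms unfolding cdiff2_def
  by (blast intro: has_derivative_transform_within_open)

lemma cdiff2_imp_isCont: "cdiff2 f x \<Longrightarrow> isCont f x"
  unfolding cdiff2_def using has_derivative_continuous by blast

lemma cdiff2_const: "cdiff2 (\<lambda>x. c) x"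
  by (rule cdiff2I[of _ "\<lambda>_. 0" _ 0 0]) (auto intro!: derivative_eq_intros)

lemma cdiff2_fst: "cdiff2 fst x"
  by (rule cdiff2I[of _ fst _ 1 0]) (auto intro!: derivative_eq_intros)

lemma cdiff2_snd: "cdiff2 snd x"
  by (rule cdiff2I[of _ snd _ 0 1]) (auto intro!: derivative_eq_intros)

lemma cdiff2_diff:
  assumes "cdiff2 f x" "cdiff2 g x"
  shows "cdiff2 (\<lambda>x. f x - g x) x"
proof -
  obtain a b where 1: "(f has_derivative (\<lambda>(h, k). a * h + b * k)) (at x)"
    using assms(1) unfolding cdiff2_def by blast
  obtain c d where 2: "(g has_derivative (\<lambda>(h, k). c * h + d * k)) (at x)"
    using assms(2) unfolding cdiff2_def by blast
  show ?thesis
    by (rule cdiff2I[OF has_derivative_diff[OF 1 2], of "a - c" "b - d"]) (simp add: algebra_simps)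
qed

lemma cdiff2_add:
  assumes "cdiff2 f x" "cdiff2 g x"
  shows "cdiff2 (\<lambda>x. f x + g x) x"
  using cdiff2_diff[OF assms(1) cdiff2_diff[OF cdiff2_const[of 0] assms(2)]] by simp

lemma cdiff2_mult:
  assumes "cdiff2 f x" "cdiff2 g x"
  shows "cdiff2 (\<lambda>x. f x * g x) x"
proof -
  obtain a b where 1: "(f has_derivative (\<lambda>(h, k). a * h + b * k)) (at x)"
    using assms(1) unfolding cdiff2_def by blast
  obtain c d where 2: "(g has_derivative (\<lambda>(h, k). c * h + d * k)) (at x)"
    using assms(2) unfolding cdiff2_def by blast
  show ?thesis
    by (rule cdiff2I[OF has_derivative_mult[OF 1 2], of "f x * c + a * g x" "f x * d + b * g x"])
      (simp add: algebra_simps)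
qed

lemma cdiff2_inverse:
  assumes "cdiff2 f x" "f x \<noteq> 0"
  shows "cdiff2 (\<lambda>x. 1 / f x) x"
proof -
  obtain a b where 1: "(f has_derivative (\<lambda>(h, k). a * h + b * k)) (at x)"
    using assms(1) unfolding cdiff2_def by blast
  have "cdiff2 (\<lambda>x. inverse (f x)) x"
    by (rule cdiff2I[OF Deriv.has_derivative_inverse[OF assms(2) 1],
          of "- (inverse (f x) * a * inverse (f x))" "- (inverse (f x) * b * inverse (f x))"])
      (simp add: algebra_simps)
  then show ?thesis by (simp add: divide_inverse)
qed

lemma cdiff2_divide:
  assumes "cdiff2 f x" "cdiff2 g x" "g x \<noteq> 0"
  shows "cdiff2 (\<lambda>x. f x / g x) x"
  using cdiff2_mult[OF assms(1) cdiff2_inverse[OF assms(2,3)]] by simp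

lemma cdiff2_power:
  assumes "cdiff2 f x"
  shows "cdiff2 (\<lambda>x. f x ^ n) x"
  by (induction n) (auto intro: cdiff2_const cdiff2_mult assms)

lemma cdiff2_compose:
  assumes "cdiff2 f (k1 x, k2 x)" "cdiff2 k1 x" "cdiff2 k2 x"
  shows "cdiff2 (\<lambda>x. f (k1 x, k2 x)) x"
proof -
  obtain a b where 0: "(f has_derivative (\<lambda>(h, k). a * h + b * k)) (at (k1 x, k2 x))"
    using assms(1) unfolding cdiff2_def by blast
  obtain c d where 1: "(k1 has_derivative (\<lambda>(h, k). c * h + d * k)) (at x)"
    using assms(2) unfolding cdiff2_def by blast
  obtain e g where 2: "(k2 has_derivative (\<lambda>(h, k). e * h + g * k)) (at x)"
    using assms(3) unfolding cdiff2_def by blast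
  show ?thesis
    by (rule cdiff2I[OF has_derivative_compose[OF has_derivative_Pair[OF 1 2] 0], of "a * c + b * e" "a * d + b * g"])
      (simp add: algebra_simps)
qed

lemmas cdiff2_intros = cdiff2_const cdiff2_fst cdiff2_snd cdiff2_diff cdiff2_add cdiff2_mult cdiff2_divide cdiff2_power

section \<open>The topology of the sphere and of the domain\<close>

lemma open_recip_preimage:
  assumes "open V"
  shows "open {z :: complex. z \<noteq> 0 \<and> 1 / z \<in> V}"
proof -
  have "open ((-{0}) \<inter> (\<lambda>z::complex. 1 / z) -` V)"
    by (rule continuous_open_preimage) (auto intro!: continuous_intros assms)
  also have "(-{0}) \<inter> (\<lambda>z::complex. 1 / z) -` V = {z. z \<noteq> 0 \<and> 1 / z \<in> V}" by auto
  finally show ?thesis .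
qed

lemma openin_sphere_top_Some: "open V \<Longrightarrow> openin sphere_top (Some ` V)"
  by (simp add: sphere_top_def)

text \<open>If \<open>V\<close> contains the origin, its image contains the point at infinity, and the finite points it misses
  form a closed set, bounded because \<open>V\<close> contains a disc around the origin.\<close>

lemma openin_sphere_top_recip:
  assumes V: "open V"
  shows "openin sphere_top (sphere_divide 1 ` V)"
proof (cases "0 \<in> V")
  case False
  have "sphere_divide 1 ` V = Some ` {z. z \<noteq> 0 \<and> 1 / z \<in> V}"
    using False by (force simp: sphere_divide_def image_iff)
  then show ?thesis
    using openin_sphere_top_Some[OF open_recip_preimage[OF V]] by simp
next
  case True
  \<comment> \<open>The finite points outside the image; \<open>C\<close> contains the origin, whose reciprocal is infinity.\<close>
  define C where "C = - {z. z \<noteq> 0 \<and> 1 / z \<in> V}"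
  have eq: "sphere_divide 1 ` V = insert None (Some ` (UNIV - C))"
    using True by (force simp: sphere_divide_def image_iff C_def)
  have "closed C"
    unfolding C_def using open_recip_preimage[OF V] by (simp add: closed_def)
  obtain e where e: "e > 0" "ball 0 e \<subseteq> V"
    using V True openE by blast
  have "norm z \<le> 1 / e" if "z \<in> C" for z
  proof (rule ccontr)
    assume "\<not> norm z \<le> 1 / e"
    then have z: "norm z > 1 / e" by simp
    then have "norm z > 0" using e(1) by (meson divide_pos_pos less_trans zero_less_one)
    moreover from this have "norm (1 / z) < e"
      using z e(1) by (simp add: norm_divide field_simps)
    ultimately show False
      using that e(2) unfolding C_def by (auto simp: subset_iff)
  qed
  then have "bounded C" by (auto simp: bounded_iff)
  with \<open>closed C\<close> have "compact C" by (simp add: compact_eq_bounded_closed)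
  then show ?thesis
    unfolding sphere_top_def openin_Alexandroff_compactification eq
    using \<open>closed C\<close> by auto
qed

lemma openin_chart_image:
  "\<phi> \<in> sphere_charts \<Longrightarrow> open V \<Longrightarrow> openin sphere_top (\<phi> ` V)"
  by (auto simp: sphere_charts_def openin_sphere_top_Some openin_sphere_top_recip)

text \<open>The reciprocal on the whole sphere. As an open involution it is its own continuous inverse, and it
  intertwines the two charts; this gives the continuity of the chart at infinity.\<close>

definition sphere_recip :: "sphere \<Rightarrow> sphere" where
  "sphere_recip x = (case x of None \<Rightarrow> Some 0 | Some z \<Rightarrow> sphere_divide 1 z)"

lemma sphere_recip_recip [simp]: "sphere_recip (sphere_recip x) = x"
  by (auto simp: sphere_recip_def sphere_divide_def split: option.splits)

lemma open_recip_image: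
  assumes "openin sphere_top U"
  shows "openin sphere_top (sphere_recip ` U)"
proof -
  from assms consider V where "open V" "U = Some ` V"
    | C where "compact C" "U = insert None (Some ` (- C))"
    by (auto simp: sphere_top_def openin_Alexandroff_compactification Compl_eq_Diff_UNIV)
  then show ?thesis
  proof cases
    case 1
    then have "sphere_recip ` U = sphere_divide 1 ` V"
      by (auto simp: image_image sphere_recip_def)
    with 1 show ?thesis by (simp add: openin_sphere_top_recip)
  next
    case 2
    obtain R where R: "R > 0" "\<And>z. z \<in> C \<Longrightarrow> norm z \<le> R"
      using compact_imp_bounded[OF 2(1)] by (auto simp: bounded_pos)
    have "Some z \<in> sphere_recip ` U" if "norm z < 1 / R" for z
    proof (cases "z = 0")
      case True
      then show ?thesis using 2(2) by (auto simp: sphere_recip_def image_iff)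
    next
      case False
      then have "norm (1 / z) > R"
        using that R(1) by (simp add: norm_divide field_simps)
      then have "1 / z \<notin> C" using R(2)[of "1 / z"] by auto
      then have "Some (1 / z) \<in> U" using 2(2) by auto
      moreover have "sphere_recip (Some (1 / z)) = Some z"
        using False by (simp add: sphere_recip_def sphere_divide_def)
      ultimately show ?thesis by (metis imageI)
    qed
    then have "Some ` ball 0 (1 / R) \<subseteq> sphere_recip ` U"
      by auto
    moreover have "sphere_recip ` U = insert (Some 0) (sphere_divide 1 ` (- C))"
      unfolding 2(2) by (simp add: image_image sphere_recip_def)
    moreover have "Some 0 \<in> Some ` ball 0 (1 / R)"
      using R(1) by auto
    ultimately have "sphere_recip ` U = Some ` ball 0 (1 / R) \<union> sphere_divide 1 ` (- C)"
      by blast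
    moreover have "open (- C)" using compact_imp_closed[OF 2(1)] by auto
    ultimately show ?thesis
      by (simp add: openin_Un openin_sphere_top_Some openin_sphere_top_recip)
  qed
qed

lemma topspace_sphere_top [simp]: "topspace sphere_top = UNIV"
  by (auto simp: sphere_top_def UNIV_option_conv)

lemma continuous_map_chart:
  assumes "\<phi> \<in> sphere_charts"
  shows "continuous_map euclidean sphere_top \<phi>"
proof -
  have S: "continuous_map euclidean sphere_top Some"
    unfolding sphere_top_def by (rule continuous_map_Some)
  have "continuous_map euclidean sphere_top (sphere_divide 1)"
    unfolding continuous_map_def
  proof (intro conjI allI impI)
    fix U assume "openin sphere_top U"
    then have "open {z. Some z \<in> sphere_recip ` U}"
      using S open_recip_image by (fastforce simp: continuous_map_def)
    moreover have "Some z \<in> sphere_recip ` U \<longleftrightarrow> sphere_divide 1 z \<in> U" for z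
    proof -
      have "sphere_divide 1 z = sphere_recip (Some z)" by (simp add: sphere_recip_def)
      then show ?thesis by (metis image_iff sphere_recip_recip)
    qed
    ultimately show "openin euclidean {z \<in> topspace euclidean. sphere_divide 1 z \<in> U}" by simp
  qed auto
  with S assms show ?thesis by (auto simp: sphere_charts_def)
qed

lemma chart_cases:
  obtains \<phi> u where "\<phi> \<in> sphere_charts" "x = \<phi> u"
proof (cases x)
  case None
  then show ?thesis using that[of "sphere_divide 1" 0] by (auto simp: sphere_charts_def sphere_divide_def)
next
  case (Some z)
  then show ?thesis using that[of Some z] by (auto simp: sphere_charts_def)
qed

lemma openin_sphere2_chart:
  assumes "\<phi> \<in> sphere_charts" "\<psi> \<in> sphere_charts" "openin sphere2_top W"
  shows "open {x. map_prod \<phi> \<psi> x \<in> W}"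
proof -
  have "continuous_map euclidean sphere2_top (map_prod \<phi> \<psi>)"
    unfolding sphere2_top_def continuous_map_pairwise
    using continuous_map_compose[OF _ continuous_map_chart[OF assms(1)], of euclidean fst]
      continuous_map_compose[OF _ continuous_map_chart[OF assms(2)], of euclidean snd]
    by (auto simp: o_def continuous_map_iff_continuous2 continuous_on_fst continuous_on_snd continuous_on_id)
  with assms(3) show ?thesis by (auto simp: continuous_map_def)
qed

text \<open>The charts are open maps covering the sphere, so openness may be tested in charts.\<close>

lemma openin_sphere2I:
  assumes "\<And>\<phi> \<psi>. \<phi> \<in> sphere_charts \<Longrightarrow> \<psi> \<in> sphere_charts \<Longrightarrow> open {x. map_prod \<phi> \<psi> x \<in> W}"
  shows "openin sphere2_top W"
proof (subst openin_subopen, intro ballI)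
  fix x assume x: "x \<in> W"
  obtain \<phi> u where \<phi>: "\<phi> \<in> sphere_charts" "fst x = \<phi> u" by (rule chart_cases)
  obtain \<psi> v where \<psi>: "\<psi> \<in> sphere_charts" "snd x = \<psi> v" by (rule chart_cases)
  have "(u, v) \<in> {x. map_prod \<phi> \<psi> x \<in> W}" using x \<phi> \<psi> by (metis map_prod_simp mem_Collect_eq prod.collapse)
  then obtain P Q where PQ: "open P" "open Q" "(u, v) \<in> P \<times> Q" "P \<times> Q \<subseteq> {x. map_prod \<phi> \<psi> x \<in> W}"
    using open_prod_elim[OF assms[OF \<phi>(1) \<psi>(1)]] by metis
  have "openin sphere2_top (\<phi> ` P \<times> \<psi> ` Q)"
    unfolding sphere2_top_def openin_prod_Times_iff
    using openin_chart_image[OF \<phi>(1) PQ(1)] openin_chart_image[OF \<psi>(1) PQ(2)] by blast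
  moreover have "x \<in> \<phi> ` P \<times> \<psi> ` Q"
    using PQ(3) \<phi> \<psi> by (metis (no_types, lifting) imageI mem_Sigma_iff prod.collapse)
  moreover have "\<phi> ` P \<times> \<psi> ` Q \<subseteq> W" using PQ(4) by auto
  ultimately show "\<exists>T. openin sphere2_top T \<and> x \<in> T \<and> T \<subseteq> W" by blast
qed

text \<open>The convention that zero times infinity is one puts the points \<open>(\<infinity>, 0)\<close> and \<open>(0, \<infinity>)\<close> on the
  removed curve \<open>z w = 1\<close>, in agreement with the equations obtained by clearing denominators.\<close>

lemma Omega_chart_iff:
  "(Some z, Some w) \<in> Omega \<longleftrightarrow> z * w \<noteq> 1"
  "(Some z, sphere_divide 1 v) \<in> Omega \<longleftrightarrow> z \<noteq> v"
  "(sphere_divide 1 u, Some w) \<in> Omega \<longleftrightarrow> u \<noteq> w"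
  "(sphere_divide 1 u, sphere_divide 1 v) \<in> Omega \<longleftrightarrow> u * v \<noteq> 1"
  by (auto simp: Omega_def sphere_divide_def field_simps)

lemma open_chart_Omega:
  assumes "\<phi> \<in> sphere_charts" "\<psi> \<in> sphere_charts"
  shows "open {x. map_prod \<phi> \<psi> x \<in> Omega}"
proof -
  have "{x. map_prod Some Some x \<in> Omega} = {x. fst x * snd x \<noteq> 1}"
    "{x. map_prod Some (sphere_divide 1) x \<in> Omega} = {x. fst x \<noteq> snd x}"
    "{x. map_prod (sphere_divide 1) Some x \<in> Omega} = {x. fst x \<noteq> snd x}"
    "{x. map_prod (sphere_divide 1) (sphere_divide 1) x \<in> Omega} = {x. fst x * snd x \<noteq> 1}"
    by (auto simp: Omega_chart_iff)
  with assms show ?thesis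
    by (auto simp: sphere_charts_def intro!: open_Collect_neq continuous_intros)
qed

lemma openin_Omega: "openin sphere2_top Omega"
  by (rule openin_sphere2I) (rule open_chart_Omega)

lemma holo_OmegaD:
  assumes "f \<in> holo_Omega" "\<phi> \<in> sphere_charts" "\<psi> \<in> sphere_charts" "map_prod \<phi> \<psi> x \<in> Omega"
  shows "cdiff2 (f \<circ> map_prod \<phi> \<psi>) x"
  using assms unfolding holo_Omega_def holomorphic2_on_cdiff2 by blast

lemma holo_openin_preimage:
  assumes f: "f \<in> holo_Omega" and V: "open V"
  shows "openin sphere2_top {x \<in> Omega. f x \<in> V}"
proof (rule openin_sphere2I)
  fix \<phi> \<psi> assume c: "\<phi> \<in> sphere_charts" "\<psi> \<in> sphere_charts"
  let ?D = "{x. map_prod \<phi> \<psi> x \<in> Omega}"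
  have "continuous_on ?D (f \<circ> map_prod \<phi> \<psi>)"
    using cdiff2_imp_isCont[OF holo_OmegaD[OF f c]]
    by (intro continuous_at_imp_continuous_on ballI) simp
  then have "open (?D \<inter> (f \<circ> map_prod \<phi> \<psi>) -` V)"
    using open_chart_Omega[OF c] V by (rule continuous_open_preimage)
  also have "?D \<inter> (f \<circ> map_prod \<phi> \<psi>) -` V = {x. map_prod \<phi> \<psi> x \<in> {x \<in> Omega. f x \<in> V}}" by auto
  finally show "open {x. map_prod \<phi> \<psi> x \<in> {x \<in> Omega. f x \<in> V}}" .
qed

lemma holo_bounded_on_compact:
  assumes f: "f \<in> holo_Omega" and K: "compactin sphere2_top K" "K \<subseteq> Omega"
  obtains M where "\<And>x. x \<in> K \<Longrightarrow> norm (f x) \<le> M"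
proof -
  have "continuous_map (subtopology sphere2_top Omega) euclidean f"
    unfolding continuous_map_def
  proof (intro conjI allI impI)
    fix V :: "complex set" assume "openin euclidean V"
    moreover have "{x \<in> topspace (subtopology sphere2_top Omega). f x \<in> V} = {x \<in> Omega. f x \<in> V}"
      using openin_subset[OF openin_Omega] by auto
    ultimately show "openin (subtopology sphere2_top Omega) {x \<in> topspace (subtopology sphere2_top Omega). f x \<in> V}"
      using holo_openin_preimage[OF f] openin_Omega by (auto simp: openin_open_subtopology)
  qed auto
  then have "compactin euclidean (f ` K)"
    using K by (intro image_compactin) (auto simp: compactin_subtopology)
  then have "bounded (f ` K)" by (simp add: compact_imp_bounded)
  then show ?thesis using that by (auto simp: bounded_iff)
qed

text \<open>In a chart, moving both coordinates by the same small nonzero amount avoids the chart's origin in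
  each of them, and the origin is the only point that can lie over infinity.\<close>

lemma finite_points_dense:
  assumes W: "openin sphere2_top W" "x \<in> W"
  obtains z w where "(Some z, Some w) \<in> W"
proof -
  obtain \<phi> u where \<phi>: "\<phi> \<in> sphere_charts" "fst x = \<phi> u" by (rule chart_cases)
  obtain \<psi> v where \<psi>: "\<psi> \<in> sphere_charts" "snd x = \<psi> v" by (rule chart_cases)
  let ?P = "{x. map_prod \<phi> \<psi> x \<in> W}"
  have P: "open ?P" by (rule openin_sphere2_chart[OF \<phi>(1) \<psi>(1) W(1)])
  have uv: "(u, v) \<in> ?P" using W(2) \<phi> \<psi> by (metis map_prod_simp mem_Collect_eq prod.collapse)
  have "((\<lambda>t. (u + t, v + t)) \<longlongrightarrow> (u + 0, v + 0)) (at 0)"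
    by (intro tendsto_intros)
  then have "\<forall>\<^sub>F t in at 0. (u + t, v + t) \<in> ?P"
    using P uv by (auto simp: tendsto_def)
  moreover have "\<forall>\<^sub>F t in at 0. t \<noteq> -u" "\<forall>\<^sub>F t in at 0. t \<noteq> -v"
    by (auto simp: eventually_neq_at_within)
  ultimately have "\<forall>\<^sub>F t in at 0. (u + t, v + t) \<in> ?P \<and> t \<noteq> -u \<and> t \<noteq> -v"
    by (auto intro: eventually_conj)
  then obtain t where t: "(u + t, v + t) \<in> ?P" "u + t \<noteq> 0" "v + t \<noteq> 0"
    using eventually_happens'[of "at (0::complex)"] by (auto simp: add_eq_0_iff)
  have fin: "\<exists>z. \<phi> s = Some z" if "\<phi> \<in> sphere_charts" "s \<noteq> 0" for \<phi> s
    using that by (auto simp: sphere_charts_def sphere_divide_def)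
  obtain z w where "\<phi> (u + t) = Some z" "\<psi> (v + t) = Some w"
    using fin \<phi>(1) \<psi>(1) t by metis
  with t(1) that show ?thesis by auto
qed

section \<open>The basis functions\<close>

text \<open>The extensions to the domain of \<open>z / (1 - z w)\<close>, \<open>w / (1 - z w)\<close> and \<open>z w / (1 - z w)\<close>, of which
  all basis functions are monomials.\<close>

definition gen_z :: "sphere \<times> sphere \<Rightarrow> complex" where
  "gen_z x = (case x of (Some z, Some w) \<Rightarrow> z / (1 - z * w) | (None, Some w) \<Rightarrow> - 1 / w | _ \<Rightarrow> 0)"

definition gen_w :: "sphere \<times> sphere \<Rightarrow> complex" where
  "gen_w x = (case x of (Some z, Some w) \<Rightarrow> w / (1 - z * w) | (Some z, None) \<Rightarrow> - 1 / z | _ \<Rightarrow> 0)"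

definition gen_zw :: "sphere \<times> sphere \<Rightarrow> complex" where
  "gen_zw x = (case x of (Some z, Some w) \<Rightarrow> z * w / (1 - z * w) | _ \<Rightarrow> - 1)"

text \<open>By truncated subtraction at least one of the last two exponents is zero. The zero value off the
  domain matters, for instance for \<open>p = q = 0\<close>, where the monomial would be one everywhere.\<close>

definition basis_fun :: "nat \<Rightarrow> nat \<Rightarrow> sphere \<times> sphere \<Rightarrow> complex" where
  "basis_fun p q x = (if x \<in> Omega then gen_zw x ^ min p q * gen_z x ^ (p - q) * gen_w x ^ (q - p) else 0)"

lemma holo_OmegaI:
  assumes "\<And>\<phi> \<psi> x. \<phi> \<in> sphere_charts \<Longrightarrow> \<psi> \<in> sphere_charts \<Longrightarrow> map_prod \<phi> \<psi> x \<in> Omega \<Longrightarrow>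
      cdiff2 (g \<circ> map_prod \<phi> \<psi>) x"
  shows "(\<lambda>x. if x \<in> Omega then g x else 0) \<in> holo_Omega"
  unfolding holo_Omega_def holomorphic2_on_cdiff2
proof (intro CollectI conjI allI impI ballI)
  fix \<phi> \<psi> x assume c: "\<phi> \<in> sphere_charts" "\<psi> \<in> sphere_charts" and x: "x \<in> {x. map_prod \<phi> \<psi> x \<in> Omega}"
  show "cdiff2 ((\<lambda>x. if x \<in> Omega then g x else 0) \<circ> map_prod \<phi> \<psi>) x"
    by (rule cdiff2_cong[OF assms[OF c] open_chart_Omega[OF c] x]) (use x in auto)
qed auto

text \<open>Each formula is regular where the chart meets the domain, also at the points over infinity; there
  the value must be the one chosen in the definitions.\<close>

lemma gen_chart:
  "gen_z (Some z, Some w) = z / (1 - z * w)"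
  "gen_w (Some z, Some w) = w / (1 - z * w)"
  "gen_zw (Some z, Some w) = z * w / (1 - z * w)"
  "z \<noteq> v \<Longrightarrow> gen_z (Some z, sphere_divide 1 v) = z * v / (v - z)"
  "z \<noteq> v \<Longrightarrow> gen_w (Some z, sphere_divide 1 v) = 1 / (v - z)"
  "z \<noteq> v \<Longrightarrow> gen_zw (Some z, sphere_divide 1 v) = z / (v - z)"
  "u \<noteq> w \<Longrightarrow> gen_z (sphere_divide 1 u, Some w) = 1 / (u - w)"
  "u \<noteq> w \<Longrightarrow> gen_w (sphere_divide 1 u, Some w) = u * w / (u - w)"
  "u \<noteq> w \<Longrightarrow> gen_zw (sphere_divide 1 u, Some w) = w / (u - w)"
  "u * v \<noteq> 1 \<Longrightarrow> gen_z (sphere_divide 1 u, sphere_divide 1 v) = v / (u * v - 1)"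
  "u * v \<noteq> 1 \<Longrightarrow> gen_w (sphere_divide 1 u, sphere_divide 1 v) = u / (u * v - 1)"
  "u * v \<noteq> 1 \<Longrightarrow> gen_zw (sphere_divide 1 u, sphere_divide 1 v) = 1 / (u * v - 1)"
  by (auto simp: gen_z_def gen_w_def gen_zw_def sphere_divide_def divide_simps)

lemma cdiff2_gen:
  assumes "\<phi> \<in> sphere_charts" "\<psi> \<in> sphere_charts" "map_prod \<phi> \<psi> x \<in> Omega"
  shows "cdiff2 (gen_z \<circ> map_prod \<phi> \<psi>) x" "cdiff2 (gen_w \<circ> map_prod \<phi> \<psi>) x"
    "cdiff2 (gen_zw \<circ> map_prod \<phi> \<psi>) x"
proof -
  let ?D = "{x. map_prod \<phi> \<psi> x \<in> Omega}"
  note op = open_chart_Omega[OF assms(1,2)]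
  have x: "x \<in> ?D" using assms(3) by simp
  have *: "cdiff2 (f \<circ> map_prod \<phi> \<psi>) x" if "cdiff2 g x" "\<And>u v. (\<phi> u, \<psi> v) \<in> Omega \<Longrightarrow> f (\<phi> u, \<psi> v) = g (u, v)" for f g
    by (rule cdiff2_cong[OF that(1) op x]) (use that(2) in auto)
  obtain a b where ab: "x = (a, b)" by (cases x)
  consider "\<phi> = Some" "\<psi> = Some" | "\<phi> = Some" "\<psi> = sphere_divide 1" | "\<phi> = sphere_divide 1" "\<psi> = Some"
    | "\<phi> = sphere_divide 1" "\<psi> = sphere_divide 1"
    using assms(1,2) by (auto simp: sphere_charts_def)
  then have "cdiff2 (gen_z \<circ> map_prod \<phi> \<psi>) x \<and> cdiff2 (gen_w \<circ> map_prod \<phi> \<psi>) x \<and> cdiff2 (gen_zw \<circ> map_prod \<phi> \<psi>) x"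
  proof cases
    case 1
    then have "1 - fst x * snd x \<noteq> 0" using x by (auto simp: ab Omega_chart_iff)
    then show ?thesis
      by (intro conjI *[of "\<lambda>x. fst x / (1 - fst x * snd x)"] *[of "\<lambda>x. snd x / (1 - fst x * snd x)"]
          *[of "\<lambda>x. fst x * snd x / (1 - fst x * snd x)"] cdiff2_intros)
        (auto simp: 1 Omega_chart_iff gen_chart)
  next
    case 2
    then have "snd x - fst x \<noteq> 0" using x by (auto simp: ab Omega_chart_iff)
    then show ?thesis
      by (intro conjI *[of "\<lambda>x. fst x * snd x / (snd x - fst x)"] *[of "\<lambda>x. 1 / (snd x - fst x)"]
          *[of "\<lambda>x. fst x / (snd x - fst x)"] cdiff2_intros)
        (auto simp: 2 Omega_chart_iff gen_chart)
  next
    case 3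
    then have "fst x - snd x \<noteq> 0" using x by (auto simp: ab Omega_chart_iff)
    then show ?thesis
      by (intro conjI *[of "\<lambda>x. 1 / (fst x - snd x)"] *[of "\<lambda>x. fst x * snd x / (fst x - snd x)"]
          *[of "\<lambda>x. snd x / (fst x - snd x)"] cdiff2_intros)
        (auto simp: 3 Omega_chart_iff gen_chart)
  next
    case 4
    then have "fst x * snd x - 1 \<noteq> 0" using x by (auto simp: ab Omega_chart_iff)
    then show ?thesis
      by (intro conjI *[of "\<lambda>x. snd x / (fst x * snd x - 1)"] *[of "\<lambda>x. fst x / (fst x * snd x - 1)"]
          *[of "\<lambda>x. 1 / (fst x * snd x - 1)"] cdiff2_intros)
        (auto simp: 4 Omega_chart_iff gen_chart)
  qed
  then show "cdiff2 (gen_z \<circ> map_prod \<phi> \<psi>) x" "cdiff2 (gen_w \<circ> map_prod \<phi> \<psi>) x"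
    "cdiff2 (gen_zw \<circ> map_prod \<phi> \<psi>) x" by auto
qed

lemma add_holo:
  "f \<in> holo_Omega \<Longrightarrow> g \<in> holo_Omega \<Longrightarrow> (\<lambda>x. f x + g x) \<in> holo_Omega"
  unfolding holo_Omega_def holomorphic2_on_cdiff2
  by (auto simp: o_def intro!: cdiff2_intros)

lemma cmult_holo: "f \<in> holo_Omega \<Longrightarrow> (\<lambda>x. c * f x) \<in> holo_Omega"
  unfolding holo_Omega_def holomorphic2_on_cdiff2
  by (auto simp: o_def intro!: cdiff2_intros)

lemma diff_holo:
  "f \<in> holo_Omega \<Longrightarrow> g \<in> holo_Omega \<Longrightarrow> (\<lambda>x. f x - g x) \<in> holo_Omega"
  unfolding holo_Omega_def holomorphic2_on_cdiff2
  by (auto simp: o_def intro!: cdiff2_intros)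

lemma zero_holo: "(\<lambda>x. 0) \<in> holo_Omega"
  unfolding holo_Omega_def holomorphic2_on_cdiff2 by (auto simp: o_def intro!: cdiff2_intros)

lemma sum_holo:
  assumes "\<And>i. i \<in> I \<Longrightarrow> f i \<in> holo_Omega"
  shows "(\<lambda>x. \<Sum>i\<in>I. a i * f i x) \<in> holo_Omega"
  using assms by (induction I rule: infinite_finite_induct) (auto simp: zero_holo intro!: add_holo cmult_holo)

lemma basis_fun_holo: "basis_fun p q \<in> holo_Omega"
proof -
  have "(\<lambda>x. if x \<in> Omega then (\<lambda>x. gen_zw x ^ min p q * gen_z x ^ (p - q) * gen_w x ^ (q - p)) x else 0) \<in> holo_Omega"
  proof (rule holo_OmegaI)
    fix \<phi> \<psi> x assume "\<phi> \<in> sphere_charts" "\<psi> \<in> sphere_charts" "map_prod \<phi> \<psi> x \<in> Omega"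
    from cdiff2_gen[OF this]
    show "cdiff2 ((\<lambda>x. gen_zw x ^ min p q * gen_z x ^ (p - q) * gen_w x ^ (q - p)) \<circ> map_prod \<phi> \<psi>) x"
      by (auto simp: o_def intro!: cdiff2_intros)
  qed
  then show ?thesis by (simp add: basis_fun_def[abs_def])
qed

lemma basis_fun_finite:
  assumes "(Some z, Some w) \<in> Omega"
  shows "basis_fun p q (Some z, Some w) = z ^ p * w ^ q / (1 - z * w) ^ max p q"
proof (cases "p \<le> q")
  case True
  then obtain d where d: "q = p + d" using le_Suc_ex by blast
  show ?thesis using assms
    by (simp add: basis_fun_def gen_chart d power_divide power_mult_distrib power_add)
next
  case False
  then obtain d where d: "p = q + d" using le_Suc_ex nat_le_linear by blast
  show ?thesis using assms
    by (simp add: basis_fun_def gen_chart d power_divide power_mult_distrib power_add)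
qed

lemma holo_off_Omega: "f \<in> holo_Omega \<Longrightarrow> x \<notin> Omega \<Longrightarrow> f x = 0"
  unfolding holo_Omega_def by blast

text \<open>The set where two holomorphic functions differ is open, so it contains a finite point unless it is
  empty.\<close>

lemma holo_eqI:
  assumes f: "f \<in> holo_Omega" and g: "g \<in> holo_Omega"
    and eq: "\<And>z w. (Some z, Some w) \<in> Omega \<Longrightarrow> f (Some z, Some w) = g (Some z, Some w)"
  shows "f = g"
proof
  fix x
  show "f x = g x"
  proof (cases "x \<in> Omega")
    case True
    have h: "(\<lambda>x. f x - g x) \<in> holo_Omega" by (rule diff_holo[OF f g])
    show ?thesis
    proof (rule ccontr)
      assume "f x \<noteq> g x"
      then have "x \<in> {x \<in> Omega. f x - g x \<in> - {0}}" using True by simp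
      then obtain z w where "(Some z, Some w) \<in> {x \<in> Omega. f x - g x \<in> - {0}}"
        using finite_points_dense[OF holo_openin_preimage[OF h, of "- {0}"]] by blast
      with eq[of z w] show False by simp
    qed
  qed (simp add: holo_off_Omega f g)
qed

lemma f_pq_eq: "f_pq p q = basis_fun p q"
  unfolding f_pq_def
proof (rule the_equality)
  fix g assume g: "g \<in> holo_Omega \<and>
    (\<forall>z w. (Some z, Some w) \<in> Omega \<longrightarrow> g (Some z, Some w) = z ^ p * w ^ q / (1 - z * w) ^ max p q)"
  show "g = basis_fun p q"
    by (rule holo_eqI) (use g basis_fun_holo in \<open>auto simp: basis_fun_finite\<close>)
qed (auto simp: basis_fun_holo basis_fun_finite)

lemma f_pq_holo: "f_pq p q \<in> holo_Omega"
  by (simp add: f_pq_eq basis_fun_holo)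

section \<open>Two holomorphic maps from the complex plane squared into the domain\<close>

text \<open>On finite points, \<open>chart_left\<close> inverts \<open>(z, w) \<mapsto> (z, w / (1 - z w))\<close> and \<open>chart_right\<close> inverts
  \<open>(z, w) \<mapsto> (z / (1 - z w), w)\<close>, because \<open>1 - z w / (1 + z w) = 1 / (1 + z w)\<close>.\<close>

definition chart_left :: "complex \<Rightarrow> complex \<Rightarrow> sphere \<times> sphere" where
  "chart_left z w = (Some z, sphere_divide w (1 + z * w))"

definition chart_right :: "complex \<Rightarrow> complex \<Rightarrow> sphere \<times> sphere" where
  "chart_right z w = (sphere_divide z (1 + z * w), Some w)"

lemma chart_left_eqs:
  "1 + z * w \<noteq> 0 \<Longrightarrow> chart_left z w = (Some z, Some (w / (1 + z * w)))"
  "w \<noteq> 0 \<Longrightarrow> chart_left z w = (Some z, sphere_divide 1 ((1 + z * w) / w))"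
  by (auto simp: chart_left_def sphere_divide_def)

lemma chart_right_eqs:
  "1 + z * w \<noteq> 0 \<Longrightarrow> chart_right z w = (Some (z / (1 + z * w)), Some w)"
  "z \<noteq> 0 \<Longrightarrow> chart_right z w = (sphere_divide 1 ((1 + z * w) / z), Some w)"
  by (auto simp: chart_right_def sphere_divide_def)

lemma chart_left_Omega: "chart_left z w \<in> Omega"
  by (cases "1 + z * w = 0") (auto simp: chart_left_def sphere_divide_def Omega_def field_simps)

lemma chart_right_Omega: "chart_right z w \<in> Omega"
  by (cases "1 + z * w = 0") (auto simp: chart_right_def sphere_divide_def Omega_def field_simps)

text \<open>In these coordinates the generators become polynomials. Where \<open>1 + z w = 0\<close> the parametrised point
  lies at infinity and the values come from \<open>z w = -1\<close>.\<close>

lemma gen_chart_left: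
  "gen_z (chart_left z w) = z * (1 + z * w)"
  "gen_w (chart_left z w) = w"
  "gen_zw (chart_left z w) = z * w"
proof -
  have "gen_z (chart_left z w) = z * (1 + z * w) \<and> gen_w (chart_left z w) = w \<and> gen_zw (chart_left z w) = z * w"
  proof (cases "1 + z * w = 0")
    case True
    then have "z \<noteq> 0" "z * w = -1" by (auto simp: add_eq_0_iff)
    with True show ?thesis
      by (simp add: chart_left_def sphere_divide_def gen_z_def gen_w_def gen_zw_def field_simps)
  next
    case False
    then have "1 - z * (w / (1 + z * w)) = 1 / (1 + z * w)" by (simp add: field_simps)
    with False show ?thesis by (simp add: chart_left_eqs(1) gen_chart)
  qed
  then show "gen_z (chart_left z w) = z * (1 + z * w)" "gen_w (chart_left z w) = w" "gen_zw (chart_left z w) = z * w"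
    by auto
qed

lemma gen_chart_right:
  "gen_z (chart_right z w) = z"
  "gen_w (chart_right z w) = w * (1 + z * w)"
  "gen_zw (chart_right z w) = z * w"
proof -
  have "gen_z (chart_right z w) = z \<and> gen_w (chart_right z w) = w * (1 + z * w) \<and> gen_zw (chart_right z w) = z * w"
  proof (cases "1 + z * w = 0")
    case True
    then have "w \<noteq> 0" "z * w = -1" by (auto simp: add_eq_0_iff)
    with True show ?thesis
      by (simp add: chart_right_def sphere_divide_def gen_z_def gen_w_def gen_zw_def field_simps)
  next
    case False
    then have "1 - z / (1 + z * w) * w = 1 / (1 + z * w)" by (simp add: field_simps)
    with False show ?thesis by (simp add: chart_right_eqs(1) gen_chart)
  qed
  then show "gen_z (chart_right z w) = z" "gen_w (chart_right z w) = w * (1 + z * w)" "gen_zw (chart_right z w) = z * w"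
    by auto
qed

lemma f_pq_chart_left:
  "f_pq p q (chart_left z w) = z ^ p * w ^ q * (1 + z * w) ^ (p - q)"
proof (cases "p \<le> q")
  case True
  then obtain d where d: "q = p + d" using le_Suc_ex by blast
  show ?thesis
    by (simp add: f_pq_eq basis_fun_def chart_left_Omega gen_chart_left d power_mult_distrib power_add)
next
  case False
  then obtain d where d: "p = q + d" using le_Suc_ex nat_le_linear by blast
  show ?thesis
    by (simp add: f_pq_eq basis_fun_def chart_left_Omega gen_chart_left d power_mult_distrib power_add)
qed

lemma f_pq_chart_right:
  "f_pq p q (chart_right z w) = z ^ p * w ^ q * (1 + z * w) ^ (q - p)"
proof (cases "p \<le> q")
  case True
  then obtain d where d: "q = p + d" using le_Suc_ex by blast
  show ?thesis
    by (simp add: f_pq_eq basis_fun_def chart_right_Omega gen_chart_right d power_mult_distrib power_add)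
next
  case False
  then obtain d where d: "p = q + d" using le_Suc_ex nat_le_linear by blast
  show ?thesis
    by (simp add: f_pq_eq basis_fun_def chart_right_Omega gen_chart_right d power_mult_distrib power_add)
qed

lemma entire2I:
  assumes "\<And>x. cdiff2 (\<lambda>x. F (fst x) (snd x)) x"
  shows "entire2 F"
  unfolding entire2_def
proof (intro conjI allI)
  have "continuous_on UNIV (\<lambda>x. F (fst x) (snd x))"
    using assms by (auto intro!: continuous_at_imp_continuous_on cdiff2_imp_isCont)
  then show "continuous_on UNIV (\<lambda>(z, w). F z w)" by (simp add: case_prod_unfold)
next
  fix w
  have "(\<lambda>z. F z w) field_differentiable (at z)" for z
  proof -
    obtain a b where "((\<lambda>x. F (fst x) (snd x)) has_derivative (\<lambda>(h, k). a * h + b * k)) (at (z, w))"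
      using assms unfolding cdiff2_def by blast
    then have "((\<lambda>z. F (fst (z, w)) (snd (z, w))) has_derivative (\<lambda>h. (\<lambda>(h, k). a * h + b * k) (h, 0))) (at z)"
      by (rule has_derivative_compose[rotated]) (auto intro!: derivative_eq_intros)
    then have "((\<lambda>z. F z w) has_field_derivative a) (at z)"
      by (simp add: has_field_derivative_def)
    then show ?thesis by (auto simp: field_differentiable_def)
  qed
  then show "(\<lambda>z. F z w) holomorphic_on UNIV"
    by (simp add: holomorphic_on_def field_differentiable_at_within)
next
  fix z
  have "F z field_differentiable (at w)" for w
  proof -
    obtain a b where "((\<lambda>x. F (fst x) (snd x)) has_derivative (\<lambda>(h, k). a * h + b * k)) (at (z, w))"
      using assms unfolding cdiff2_def by blast
    then have "((\<lambda>w. F (fst (z, w)) (snd (z, w))) has_derivative (\<lambda>k. (\<lambda>(h, k). a * h + b * k) (0, k))) (at w)"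
      by (rule has_derivative_compose[rotated]) (auto intro!: derivative_eq_intros)
    then have "(F z has_field_derivative b) (at w)"
      by (simp add: has_field_derivative_def)
    then show ?thesis by (auto simp: field_differentiable_def)
  qed
  then show "F z holomorphic_on UNIV"
    by (simp add: holomorphic_on_def field_differentiable_at_within)
qed

text \<open>Where \<open>1 + z w\<close> vanishes, \<open>w\<close> does not, and near such a point the second coordinate is the
  reciprocal of \<open>(1 + z w) / w\<close>, which is read in the chart at infinity.\<close>

lemma entire2_chart_left:
  assumes f: "f \<in> holo_Omega"
  shows "entire2 (\<lambda>z w. f (chart_left z w))"
proof (rule entire2I)
  fix x :: "complex \<times> complex"
  show "cdiff2 (\<lambda>x. f (chart_left (fst x) (snd x))) x"
  proof (cases "1 + fst x * snd x = 0")
    case False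
    have "cdiff2 (f \<circ> map_prod Some Some) (fst x, snd x / (1 + fst x * snd x))"
      using False by (intro holo_OmegaD[OF f])
        (auto simp: sphere_charts_def chart_left_eqs[symmetric] chart_left_Omega)
    then have 1: "cdiff2 (\<lambda>x. (f \<circ> map_prod Some Some) (fst x, snd x / (1 + fst x * snd x))) x"
      by (rule cdiff2_compose[where ?k1.0 = "fst" and ?k2.0 = "\<lambda>x. snd x / (1 + fst x * snd x)"])
        (use False in \<open>auto intro!: cdiff2_intros\<close>)
    show ?thesis
      by (rule cdiff2_cong[OF 1, of "{x. 1 + fst x * snd x \<noteq> 0}"])
        (use False in \<open>auto simp: chart_left_eqs intro!: open_Collect_neq continuous_intros\<close>)
  next
    case True
    then have nz: "snd x \<noteq> 0" by auto
    have "cdiff2 (f \<circ> map_prod Some (sphere_divide 1)) (fst x, (1 + fst x * snd x) / snd x)"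
      using nz by (intro holo_OmegaD[OF f])
        (auto simp: sphere_charts_def chart_left_eqs(2)[symmetric] chart_left_Omega)
    then have 1: "cdiff2 (\<lambda>x. (f \<circ> map_prod Some (sphere_divide 1)) (fst x, (1 + fst x * snd x) / snd x)) x"
      by (rule cdiff2_compose[where ?k1.0 = "fst" and ?k2.0 = "\<lambda>x. (1 + fst x * snd x) / snd x"])
        (use nz in \<open>auto intro!: cdiff2_intros\<close>)
    show ?thesis
      by (rule cdiff2_cong[OF 1, of "{x. snd x \<noteq> 0}"])
        (use nz in \<open>auto simp: chart_left_eqs(2) intro!: open_Collect_neq continuous_intros\<close>)
  qed
qed

lemma entire2_chart_right:
  assumes f: "f \<in> holo_Omega"
  shows "entire2 (\<lambda>z w. f (chart_right z w))"
proof (rule entire2I)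
  fix x :: "complex \<times> complex"
  show "cdiff2 (\<lambda>x. f (chart_right (fst x) (snd x))) x"
  proof (cases "1 + fst x * snd x = 0")
    case False
    have "cdiff2 (f \<circ> map_prod Some Some) (fst x / (1 + fst x * snd x), snd x)"
      using False by (intro holo_OmegaD[OF f])
        (auto simp: sphere_charts_def chart_right_eqs[symmetric] chart_right_Omega)
    then have 1: "cdiff2 (\<lambda>x. (f \<circ> map_prod Some Some) (fst x / (1 + fst x * snd x), snd x)) x"
      by (rule cdiff2_compose[where ?k1.0 = "\<lambda>x. fst x / (1 + fst x * snd x)" and ?k2.0 = "snd"])
        (use False in \<open>auto intro!: cdiff2_intros\<close>)
    show ?thesis
      by (rule cdiff2_cong[OF 1, of "{x. 1 + fst x * snd x \<noteq> 0}"])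
        (use False in \<open>auto simp: chart_right_eqs intro!: open_Collect_neq continuous_intros\<close>)
  next
    case True
    then have nz: "fst x \<noteq> 0" by auto
    have "cdiff2 (f \<circ> map_prod (sphere_divide 1) Some) ((1 + fst x * snd x) / fst x, snd x)"
      using nz by (intro holo_OmegaD[OF f])
        (auto simp: sphere_charts_def chart_right_eqs(2)[symmetric] chart_right_Omega)
    then have 1: "cdiff2 (\<lambda>x. (f \<circ> map_prod (sphere_divide 1) Some) ((1 + fst x * snd x) / fst x, snd x)) x"
      by (rule cdiff2_compose[where ?k1.0 = "\<lambda>x. (1 + fst x * snd x) / fst x" and ?k2.0 = "snd"])
        (use nz in \<open>auto intro!: cdiff2_intros\<close>)
    show ?thesis
      by (rule cdiff2_cong[OF 1, of "{x. fst x \<noteq> 0}"])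
        (use nz in \<open>auto simp: chart_right_eqs(2) intro!: open_Collect_neq continuous_intros\<close>)
  qed
qed

lemma compactin_torus_image:
  fixes g :: "complex \<Rightarrow> complex \<Rightarrow> sphere \<times> sphere"
  assumes "continuous_map euclidean sphere2_top (\<lambda>x. g (fst x) (snd x))"
  shows "compactin sphere2_top ((\<lambda>(z, w). g z w) ` (sphere 0 1 \<times> sphere 0 1))"
proof -
  have "compactin euclidean (sphere (0 :: complex) 1 \<times> sphere (0 :: complex) 1)"
    by (simp add: compact_Times)
  from image_compactin[OF this assms] show ?thesis
    by (simp add: case_prod_unfold)
qed

text \<open>The preimage of an open set is the union of its parts in the two regions where one of the formulas
  for the parametrisation is available.\<close>

lemma continuous_map_charts:
  "continuous_map euclidean sphere2_top (\<lambda>x. chart_left (fst x) (snd x))"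
  "continuous_map euclidean sphere2_top (\<lambda>x. chart_right (fst x) (snd x))"
proof -
  have *: "continuous_map euclidean sphere2_top g"
    if g: "\<And>x. x \<in> P \<Longrightarrow> g x = map_prod Some Some (k x)" "\<And>x. x \<in> Q \<Longrightarrow> g x = map_prod \<phi> \<psi> (l x)"
      and c: "\<phi> \<in> sphere_charts" "\<psi> \<in> sphere_charts"
      and o: "open P" "open Q" "P \<union> Q = UNIV"
      and kl: "continuous_on P k" "continuous_on Q l"
    for g :: "complex \<times> complex \<Rightarrow> sphere \<times> sphere" and P Q k l \<phi> \<psi>
    unfolding continuous_map_def
  proof (intro conjI allI impI)
    fix U assume U: "openin sphere2_top U"
    have s: "Some \<in> sphere_charts" by (simp add: sphere_charts_def)
    have "open (P \<inter> k -` {x. map_prod Some Some x \<in> U})"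
      by (rule continuous_open_preimage[OF kl(1) o(1) openin_sphere2_chart[OF s s U]])
    moreover have "open (Q \<inter> l -` {x. map_prod \<phi> \<psi> x \<in> U})"
      by (rule continuous_open_preimage[OF kl(2) o(2) openin_sphere2_chart[OF c U]])
    moreover have "{x. g x \<in> U} = (P \<inter> k -` {x. map_prod Some Some x \<in> U}) \<union> (Q \<inter> l -` {x. map_prod \<phi> \<psi> x \<in> U})"
    proof (rule set_eqI)
      fix x
      show "x \<in> {x. g x \<in> U} \<longleftrightarrow> x \<in> (P \<inter> k -` {x. map_prod Some Some x \<in> U}) \<union> (Q \<inter> l -` {x. map_prod \<phi> \<psi> x \<in> U})"
      proof (cases "x \<in> P")
        case True
        then show ?thesis using g(1)[OF True] g(2)[of x] by auto
      next
        case False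
        then have "x \<in> Q" using o(3) by blast
        then show ?thesis using g(2)[of x] False by auto
      qed
    qed
    ultimately show "openin euclidean {x \<in> topspace euclidean. g x \<in> U}"
      by (simp add: open_Un)
  qed (auto simp: sphere2_top_def)
  show "continuous_map euclidean sphere2_top (\<lambda>x. chart_left (fst x) (snd x))"
    by (rule *[of "{x. 1 + fst x * snd x \<noteq> 0}" _ "\<lambda>x. (fst x, snd x / (1 + fst x * snd x))" "{x. snd x \<noteq> 0}"
          Some "sphere_divide 1" "\<lambda>x. (fst x, (1 + fst x * snd x) / snd x)"])
      (auto simp: chart_left_eqs sphere_charts_def intro!: open_Collect_neq continuous_intros)
  show "continuous_map euclidean sphere2_top (\<lambda>x. chart_right (fst x) (snd x))"
    by (rule *[of "{x. 1 + fst x * snd x \<noteq> 0}" _ "\<lambda>x. (fst x / (1 + fst x * snd x), snd x)" "{x. fst x \<noteq> 0}"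
          "sphere_divide 1" Some "\<lambda>x. ((1 + fst x * snd x) / fst x, snd x)"])
      (auto simp: chart_right_eqs sphere_charts_def intro!: open_Collect_neq continuous_intros)
qed

section \<open>Biorthogonality and continuity of the coefficient functionals\<close>

lemma coeff_integral_eq_torus_coeff:
  "coeff_integral f p q =
    (if p < q then torus_coeff (\<lambda>z w. f (chart_left z w)) p q else torus_coeff (\<lambda>z w. f (chart_right z w)) p q)"
  by (simp add: coeff_integral_def torus_coeff_def chart_left_def chart_right_def)

lemma continuous_on_chart_torus:
  assumes "f \<in> holo_Omega"
  shows "continuous_on (sphere 0 1 \<times> sphere 0 1) (\<lambda>(z, w). f (chart_left z w))"
    "continuous_on (sphere 0 1 \<times> sphere 0 1) (\<lambda>(z, w). f (chart_right z w))"
  using entire2_chart_left[OF assms] entire2_chart_right[OF assms]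
  by (auto simp: entire2_def intro: continuous_on_subset)

lemma coeff_integral_sum:
  assumes "finite I" "\<And>i. i \<in> I \<Longrightarrow> f i \<in> holo_Omega"
  shows "coeff_integral (\<lambda>x. \<Sum>i\<in>I. a i * f i x) p q = (\<Sum>i\<in>I. a i * coeff_integral (f i) p q)"
  using torus_coeff_sum[OF continuous_on_chart_torus(1)[OF assms(2)] assms(1)]
    torus_coeff_sum[OF continuous_on_chart_torus(2)[OF assms(2)] assms(1)]
  by (auto simp: coeff_integral_eq_torus_coeff)

lemma torus_coeff_shifted_monomial:
  "torus_coeff (\<lambda>z w. z ^ m * w ^ n * (1 + z * w) ^ k) p q =
    (\<Sum>i\<le>k. of_nat (k choose i) * (if m + i = p \<and> n + i = q then 1 else 0))"
proof -
  have "z ^ m * w ^ n * (1 + z * w) ^ k = (\<Sum>i\<le>k. of_nat (k choose i) * (z ^ (m + i) * w ^ (n + i)))"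
    for z w :: complex
  proof -
    have "(1 + z * w) ^ k = (\<Sum>i\<le>k. of_nat (k choose i) * (z * w) ^ i)"
      using binomial_ring[of "z * w" 1 k] by (simp add: add.commute)
    then show ?thesis
      by (simp add: sum_distrib_left power_add power_mult_distrib mult_ac)
  qed
  then have "torus_coeff (\<lambda>z w. z ^ m * w ^ n * (1 + z * w) ^ k) p q =
      torus_coeff (\<lambda>z w. \<Sum>i\<le>k. of_nat (k choose i) * (z ^ (m + i) * w ^ (n + i))) p q"
    by simp
  also have "\<dots> = (\<Sum>i\<le>k. of_nat (k choose i) * torus_coeff (\<lambda>z w. z ^ (m + i) * w ^ (n + i)) p q)"
    by (rule torus_coeff_sum) (auto simp: case_prod_unfold intro!: continuous_intros)
  finally show ?thesis by (simp only: torus_coeff_monomial)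
qed

text \<open>For \<open>p < q\<close>, the monomials \<open>z ^ (m + i) * w ^ (n + i)\<close> of \<open>f_pq m n\<close> in the first parametrisation
  occur with \<open>i > 0\<close> only when \<open>m > n\<close>, and then cannot have exponents \<open>p < q\<close>. The case \<open>p \<ge> q\<close> is
  symmetric.\<close>

lemma coeff_integral_f_pq:
  "coeff_integral (f_pq m n) p q = (if m = p \<and> n = q then 1 else 0)"
proof (cases "p < q")
  case True
  have "(if m + i = p \<and> n + i = q then 1 else 0) = (if i = 0 \<and> m = p \<and> n = q then 1 else (0::complex))"
    if "i \<le> m - n" for i
    using that True by auto
  then have "coeff_integral (f_pq m n) p q =
      (\<Sum>i\<le>m - n. of_nat ((m - n) choose i) * (if i = 0 \<and> m = p \<and> n = q then 1 else 0))"
    using True by (simp add: coeff_integral_eq_torus_coeff f_pq_chart_left torus_coeff_shifted_monomial)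
  also have "\<dots> = (\<Sum>i\<in>{0}. of_nat ((m - n) choose i) * (if i = 0 \<and> m = p \<and> n = q then 1 else 0))"
    by (rule sum.mono_neutral_right) auto
  finally show ?thesis by simp
next
  case False
  have "(if m + i = p \<and> n + i = q then 1 else 0) = (if i = 0 \<and> m = p \<and> n = q then 1 else (0::complex))"
    if "i \<le> n - m" for i
    using that False by auto
  then have "coeff_integral (f_pq m n) p q =
      (\<Sum>i\<le>n - m. of_nat ((n - m) choose i) * (if i = 0 \<and> m = p \<and> n = q then 1 else 0))"
    using False by (simp add: coeff_integral_eq_torus_coeff f_pq_chart_right torus_coeff_shifted_monomial)
  also have "\<dots> = (\<Sum>i\<in>{0}. of_nat ((n - m) choose i) * (if i = 0 \<and> m = p \<and> n = q then 1 else 0))"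
    by (rule sum.mono_neutral_right) auto
  finally show ?thesis by simp
qed

text \<open>The functional is bounded by the supremum over the image of the unit torus, which is a compact subset
  of the domain.\<close>

lemma continuous_map_coeff_integral:
  "continuous_map holo_top euclidean (\<lambda>f. coeff_integral f p q)"
proof -
  define g where "g = (if p < q then chart_left else chart_right)"
  \<comment> \<open>The image of the unit torus under the parametrisation that belongs to \<open>(p, q)\<close>.\<close>
  define K where "K = (\<lambda>(z, w). g z w) ` (sphere 0 1 \<times> sphere 0 1)"
  have K: "compactin sphere2_top K" "K \<subseteq> Omega"
    using compactin_torus_image[OF continuous_map_charts(1)] compactin_torus_image[OF continuous_map_charts(2)]
      chart_left_Omega chart_right_Omega
    unfolding K_def g_def by auto
  have bound: "norm (coeff_integral h p q - coeff_integral f p q) \<le> e"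
    if "f \<in> holo_Omega" "h \<in> holo_Omega" "\<And>x. x \<in> K \<Longrightarrow> norm (h x - f x) \<le> e" for f h e
  proof -
    have "norm (torus_coeff (\<lambda>z w. h (g z w)) p q - torus_coeff (\<lambda>z w. f (g z w)) p q) \<le> e"
    proof (rule torus_coeff_diff_bound)
      show "continuous_on (sphere 0 1 \<times> sphere 0 1) (\<lambda>(z, w). h (g z w))"
        "continuous_on (sphere 0 1 \<times> sphere 0 1) (\<lambda>(z, w). f (g z w))"
        using continuous_on_chart_torus that(1,2) unfolding g_def by auto
      show "norm (h (g z w) - f (g z w)) \<le> e" if "norm z = 1" "norm w = 1" for z w
        by (rule \<open>\<And>x. x \<in> K \<Longrightarrow> norm (h x - f x) \<le> e\<close>) (use that in \<open>auto simp: K_def\<close>)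
    qed
    then show ?thesis by (auto simp: coeff_integral_eq_torus_coeff g_def)
  qed
  show ?thesis
    unfolding continuous_map_def
  proof (intro conjI allI impI)
    fix V :: "complex set" assume "openin euclidean V"
    then have V: "open V" by simp
    show "openin holo_top {f \<in> topspace holo_top. coeff_integral f p q \<in> V}"
      unfolding openin_holo_top holo_open_def topspace_holo_top
    proof (intro conjI ballI)
      fix f assume f: "f \<in> {f \<in> holo_Omega. coeff_integral f p q \<in> V}"
      then obtain e where e: "e > 0" "ball (coeff_integral f p q) e \<subseteq> V"
        using V openE by blast
      have "holo_nbhd f K (e / 2) \<subseteq> {f \<in> holo_Omega. coeff_integral f p q \<in> V}"
      proof
        fix h assume h: "h \<in> holo_nbhd f K (e / 2)"
        then have "norm (coeff_integral h p q - coeff_integral f p q) \<le> e / 2"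
          using f by (intro bound) (auto simp: holo_nbhd_def less_imp_le)
        then have "coeff_integral h p q \<in> ball (coeff_integral f p q) e"
          using e(1) by (simp add: dist_norm norm_minus_commute)
        then show "h \<in> {f \<in> holo_Omega. coeff_integral f p q \<in> V}"
          using e(2) h by (auto simp: holo_nbhd_def)
      qed
      then show "\<exists>K \<epsilon>. compactin sphere2_top K \<and> K \<subseteq> Omega \<and> \<epsilon> > 0 \<and>
          holo_nbhd f K \<epsilon> \<subseteq> {f \<in> holo_Omega. coeff_integral f p q \<in> V}"
        using K e(1) by (intro exI[of _ K] exI[of _ "e / 2"]) auto
    qed auto
  qed auto
qed

section \<open>Convergence of series with rapidly decaying coefficients\<close>

lemma rapid_coeff_integral:
  assumes f: "f \<in> holo_Omega"
  shows "rapid (coeff_integral f)"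
  unfolding rapid_def
proof (intro allI impI)
  fix M :: real assume M: "M > 0"
  let ?c = "torus_coeff (\<lambda>z w. f (chart_left z w))" and ?e = "torus_coeff (\<lambda>z w. f (chart_right z w))"
  have "(\<lambda>x. (case x of (p, q) \<Rightarrow> norm (?c p q) * M ^ (p + q)) + (case x of (p, q) \<Rightarrow> norm (?e p q) * M ^ (p + q))) summable_on UNIV"
    using rapid_torus_coeff[OF entire2_chart_left[OF f]] rapid_torus_coeff[OF entire2_chart_right[OF f]] M
    unfolding rapid_def by (intro summable_on_add) auto
  then show "(\<lambda>(p, q). norm (coeff_integral f p q) * M ^ (p + q)) summable_on UNIV"
    by (rule summable_on_comparison_test) (use M in \<open>auto simp: coeff_integral_eq_torus_coeff\<close>)
qed

text \<open>On the domain, \<open>f_pq p q\<close> is a monomial of degree \<open>max p q\<close> in \<open>f_pq 1 0\<close>, \<open>f_pq 0 1\<close> and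
  \<open>f_pq 1 1\<close>.\<close>

lemma f_pq_bound:
  assumes "x \<in> Omega" "norm (f_pq 1 0 x) \<le> M" "norm (f_pq 0 1 x) \<le> M" "norm (f_pq 1 1 x) \<le> M" "M \<ge> 1"
  shows "norm (f_pq p q x) \<le> M ^ (p + q)"
proof -
  have "norm (f_pq p q x) = norm (f_pq 1 1 x) ^ min p q * norm (f_pq 1 0 x) ^ (p - q) * norm (f_pq 0 1 x) ^ (q - p)"
    using assms(1) by (simp add: f_pq_eq basis_fun_def norm_mult norm_power)
  also have "\<dots> \<le> M ^ min p q * M ^ (p - q) * M ^ (q - p)"
    using assms by (intro mult_mono power_mono) auto
  also have "\<dots> = M ^ (min p q + (p - q) + (q - p))" by (simp add: power_add)
  also have "\<dots> \<le> M ^ (p + q)" using assms(5) by (intro power_increasing) auto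
  finally show ?thesis .
qed

lemma f_pq_bound_compact:
  assumes "compactin sphere2_top K" "K \<subseteq> Omega"
  obtains M where "M > 0" "\<And>x p q. x \<in> K \<Longrightarrow> norm (f_pq p q x) \<le> M ^ (p + q)"
proof -
  obtain M1 where M1: "\<And>x. x \<in> K \<Longrightarrow> norm (f_pq 1 0 x) \<le> M1"
    using holo_bounded_on_compact[OF f_pq_holo assms] by metis
  obtain M2 where M2: "\<And>x. x \<in> K \<Longrightarrow> norm (f_pq 0 1 x) \<le> M2"
    using holo_bounded_on_compact[OF f_pq_holo assms] by metis
  obtain M3 where M3: "\<And>x. x \<in> K \<Longrightarrow> norm (f_pq 1 1 x) \<le> M3"
    using holo_bounded_on_compact[OF f_pq_holo assms] by metis
  show ?thesis
  proof (rule that)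
    show "max 1 (max M1 (max M2 M3)) > 0" by simp
    show "norm (f_pq p q x) \<le> (max 1 (max M1 (max M2 M3))) ^ (p + q)" if "x \<in> K" for x p q
      using M1[OF that] M2[OF that] M3[OF that] that assms(2) by (intro f_pq_bound) auto
  qed
qed

lemma f_pq_bound_local:
  assumes "x \<in> Omega"
  obtains U M where "openin sphere2_top U" "x \<in> U" "U \<subseteq> Omega" "M > 0"
    "\<And>x p q. x \<in> U \<Longrightarrow> norm (f_pq p q x) \<le> M ^ (p + q)"
proof -
  define M where "M = 1 + norm (f_pq 1 0 x) + norm (f_pq 0 1 x) + norm (f_pq 1 1 x)"
  let ?U = "\<lambda>p q. {y \<in> Omega. f_pq p q y \<in> ball 0 M}"
  show ?thesis
  proof (rule that[of "?U 1 0 \<inter> ?U 0 1 \<inter> ?U 1 1" M])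
    show "openin sphere2_top (?U 1 0 \<inter> ?U 0 1 \<inter> ?U 1 1)"
      by (intro openin_Int holo_openin_preimage f_pq_holo open_ball)
    show "x \<in> ?U 1 0 \<inter> ?U 0 1 \<inter> ?U 1 1"
      using assms unfolding M_def by (auto simp: add_pos_nonneg add_nonneg_pos)
    show "M > 0" unfolding M_def by (simp add: add_pos_nonneg)
    have "M \<ge> 1" unfolding M_def by simp
    then show "norm (f_pq p q y) \<le> M ^ (p + q)" if "y \<in> ?U 1 0 \<inter> ?U 0 1 \<inter> ?U 1 1" for y p q
      using that by (intro f_pq_bound) auto
  qed auto
qed

lemma uniform_limit_f_pq_series:
  assumes a: "rapid a" and M: "M > 0" "\<And>x p q. x \<in> S \<Longrightarrow> norm (f_pq p q x) \<le> M ^ (p + q)"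
    and f: "\<And>x. x \<in> S \<Longrightarrow> ((\<lambda>(p, q). a p q * f_pq p q x) has_sum f x) UNIV"
  shows "uniform_limit S (\<lambda>F y. \<Sum>(p, q)\<in>F. a p q * f_pq p q y) f (finite_subsets_at_top UNIV)"
  unfolding case_prod_unfold
proof (rule Weierstrass_m_test_general')
  show "(\<lambda>x. norm (a (fst x) (snd x)) * M ^ (fst x + snd x)) summable_on UNIV"
    using a M(1) unfolding rapid_def by (simp add: case_prod_unfold)
  show "norm (a (fst i) (snd i) * f_pq (fst i) (snd i) x) \<le> norm (a (fst i) (snd i)) * M ^ (fst i + snd i)"
    if "x \<in> S" for i x
    using M(2)[OF that] by (simp add: norm_mult mult_left_mono)
  show "((\<lambda>i. a (fst i) (snd i) * f_pq (fst i) (snd i) x) has_sum f x) UNIV" if "x \<in> S" for x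
    using f[OF that] by (simp add: case_prod_unfold)
qed

lemma f_pq_series_abs_summable:
  assumes a: "rapid a" and x: "x \<in> Omega"
  shows "(\<lambda>(p, q). norm (a p q * f_pq p q x)) summable_on UNIV"
proof -
  obtain U M where "x \<in> U" "M > 0" "\<And>x p q. x \<in> U \<Longrightarrow> norm (f_pq p q x) \<le> M ^ (p + q)"
    using f_pq_bound_local[OF x] by metis
  then show ?thesis by (intro rapid_summable[OF a]) blast+
qed

lemma f_pq_series_has_sum:
  assumes a: "rapid a" and x: "x \<in> Omega"
  shows "((\<lambda>(p, q). a p q * f_pq p q x) has_sum (\<Sum>\<^sub>\<infinity>(p, q). a p q * f_pq p q x)) UNIV"
proof (rule has_sum_infsum[OF abs_summable_summable])
  show "(\<lambda>i. norm (case i of (p, q) \<Rightarrow> a p q * f_pq p q x)) summable_on UNIV"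
    using f_pq_series_abs_summable[OF a x] by (simp add: case_prod_unfold)
qed

section \<open>The expansion of a holomorphic function\<close>

text \<open>Both Taylor series represent \<open>f\<close> along the whole circle of points \<open>(t z, w / t)\<close>, on which \<open>z w\<close> is
  constant. Hence the parts of the two series with \<open>p \<ge> q\<close> have the same sum, and exchanging one for the
  other turns the first series into the claimed one.\<close>

lemma finite_expansion:
  assumes f: "f \<in> holo_Omega" and zw: "(Some z, Some w) \<in> Omega"
  shows "((\<lambda>(p, q). coeff_integral f p q * f_pq p q (Some z, Some w)) has_sum f (Some z, Some w)) UNIV"
proof -
  define c where "c = torus_coeff (\<lambda>z w. f (chart_left z w))"
  define e where "e = torus_coeff (\<lambda>z w. f (chart_right z w))"
  note F = entire2_chart_left[OF f] and G = entire2_chart_right[OF f]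
  have nz: "1 - z * w \<noteq> 0" using zw by (simp add: Omega_chart_iff)
  define X where "X = (\<lambda>p q. c p q * (z ^ p * (w / (1 - z * w)) ^ q))"
  define Y where "Y = (\<lambda>p q. e p q * ((z / (1 - z * w)) ^ p * w ^ q))"
  define N where "N = max 1 (max (max (norm z) (norm w)) (max (norm (z / (1 - z * w))) (norm (w / (1 - z * w)))))"
  have N: "N > 0" "norm z \<le> N" "norm w \<le> N" "norm (z / (1 - z * w)) \<le> N" "norm (w / (1 - z * w)) \<le> N"
    unfolding N_def by auto
  have mono: "norm (u ^ p * v ^ q) \<le> N ^ (p + q)" if "norm u \<le> N" "norm v \<le> N" for u v :: complex and p q
    using that N(1) by (simp add: norm_mult norm_power power_add mult_mono power_mono)
  have absX: "(\<lambda>(p, q). norm (X p q)) summable_on UNIV"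
    unfolding X_def c_def by (rule rapid_summable[OF rapid_torus_coeff[OF F] N(1)]) (rule mono; fact N)
  have absY: "(\<lambda>(p, q). norm (Y p q)) summable_on UNIV"
    unfolding Y_def e_def by (rule rapid_summable[OF rapid_torus_coeff[OF G] N(1)]) (rule mono; fact N)
  have X: "((\<lambda>(p, q). X p q * (t ^ p / t ^ q)) has_sum f (Some (t * z), Some (w / t))) UNIV"
    if "t \<noteq> 0" for t
  proof -
    have "1 + t * z * (w / t / (1 - z * w)) = 1 / (1 - z * w)"
      using nz that by (simp add: field_simps)
    then have "chart_left (t * z) (w / t / (1 - z * w)) = (Some (t * z), Some (w / t))"
      using nz by (simp add: chart_left_eqs(1))
    moreover have "c p q * ((t * z) ^ p * (w / t / (1 - z * w)) ^ q) = X p q * (t ^ p / t ^ q)" for p q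
      by (simp add: X_def power_mult_distrib power_divide mult_ac)
    ultimately show ?thesis
      using entire2_expansion[OF F, of "t * z" "w / t / (1 - z * w)"] by (simp add: c_def)
  qed
  have Y: "((\<lambda>(p, q). Y p q * (t ^ p / t ^ q)) has_sum f (Some (t * z), Some (w / t))) UNIV"
    if "t \<noteq> 0" for t
  proof -
    have "1 + t * z / (1 - z * w) * (w / t) = 1 / (1 - z * w)"
      using nz that by (simp add: field_simps)
    then have "chart_right (t * z / (1 - z * w)) (w / t) = (Some (t * z), Some (w / t))"
      using nz by (simp add: chart_right_eqs(1))
    moreover have "e p q * ((t * z / (1 - z * w)) ^ p * (w / t) ^ q) = Y p q * (t ^ p / t ^ q)" for p q
      by (simp add: Y_def power_mult_distrib power_divide mult_ac)
    ultimately show ?thesis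
      using entire2_expansion[OF G, of "t * z / (1 - z * w)" "w / t"] by (simp add: e_def)
  qed
  have "((\<lambda>(p, q). X p q - Y p q) has_sum 0) {(p, q). p \<ge> q}"
  proof (rule fourier_nonneg_part)
    have "(\<lambda>x. (case x of (p, q) \<Rightarrow> norm (X p q)) + (case x of (p, q) \<Rightarrow> norm (Y p q))) summable_on UNIV"
      by (rule summable_on_add[OF absX absY])
    then show "(\<lambda>(p, q). norm (X p q - Y p q)) summable_on UNIV"
      by (rule summable_on_comparison_test) (auto simp: norm_triangle_ineq4)
    fix t :: complex assume "norm t = 1"
    then have "t \<noteq> 0" by auto
    from has_sum_add[OF X[OF this] has_sum_uminusI[OF Y[OF this]]]
    show "((\<lambda>(p, q). (X p q - Y p q) * (t ^ p / t ^ q)) has_sum 0) UNIV"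
      by (simp add: case_prod_unfold algebra_simps diff_divide_distrib)
  qed
  \<comment> \<open>Subtracting this null series from the first expansion replaces its terms with \<open>p \<ge> q\<close> by those of the second.\<close>
  then have "((\<lambda>(p, q). if q \<le> p then X p q - Y p q else 0) has_sum 0) UNIV"
    by (subst (asm) has_sum_cong_neutral[where T = UNIV and g = "\<lambda>(p, q). if q \<le> p then X p q - Y p q else 0"])
      (auto split: if_splits)
  from has_sum_add[OF X[of 1] has_sum_uminusI[OF this]]
  have "((\<lambda>(p, q). X p q - (if q \<le> p then X p q - Y p q else 0)) has_sum f (Some z, Some w)) UNIV"
    by (simp add: case_prod_unfold)
  moreover have "X p q - (if q \<le> p then X p q - Y p q else 0) = coeff_integral f p q * f_pq p q (Some z, Some w)" for p q
    using basis_fun_finite[OF zw, of p q]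
    by (auto simp: X_def Y_def coeff_integral_eq_torus_coeff c_def e_def f_pq_eq power_divide max_def not_le)
  ultimately show ?thesis by simp
qed

text \<open>The sum \<open>g\<close> of the series agrees with \<open>f\<close> at the finite points. At any other point, compare both
  with a partial sum that is uniformly close to \<open>g\<close> nearby: its difference to \<open>f\<close> is continuous and is small
  at a finite point close by.\<close>

lemma expansion:
  assumes f: "f \<in> holo_Omega" and x: "x \<in> Omega"
  shows "((\<lambda>(p, q). coeff_integral f p q * f_pq p q x) has_sum f x) UNIV"
proof -
  let ?a = "coeff_integral f"
  note a = rapid_coeff_integral[OF f]
  define g where "g = (\<lambda>x. \<Sum>\<^sub>\<infinity>(p, q). ?a p q * f_pq p q x)"
  have g: "((\<lambda>(p, q). ?a p q * f_pq p q y) has_sum g y) UNIV" if "y \<in> Omega" for y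
    unfolding g_def by (rule f_pq_series_has_sum[OF a that])
  obtain U M where U: "openin sphere2_top U" "x \<in> U" "U \<subseteq> Omega" "M > 0"
    "\<And>x p q. x \<in> U \<Longrightarrow> norm (f_pq p q x) \<le> M ^ (p + q)"
    using f_pq_bound_local[OF x] by metis
  have "norm (f x - g x) \<le> 3 * \<epsilon>" if \<epsilon>: "\<epsilon> > 0" for \<epsilon>
  proof -
    have "uniform_limit U (\<lambda>F y. \<Sum>(p, q)\<in>F. ?a p q * f_pq p q y) g (finite_subsets_at_top UNIV)"
      using U g by (intro uniform_limit_f_pq_series[OF a U(4)]) auto
    from uniform_limitD[OF this \<epsilon>] obtain I
      where I: "\<And>y. y \<in> U \<Longrightarrow> dist (\<Sum>(p, q)\<in>I. ?a p q * f_pq p q y) (g y) < \<epsilon>"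
      using eventually_happens'[of "finite_subsets_at_top UNIV"] by fastforce
    \<comment> \<open>Near \<open>x\<close> this is within \<open>\<epsilon>\<close> of its value at \<open>x\<close>, and it is smaller than \<open>\<epsilon>\<close> at finite points, where \<open>f = g\<close>.\<close>
    define h where "h = (\<lambda>y. f y - (\<Sum>i\<in>I. ?a (fst i) (snd i) * f_pq (fst i) (snd i) y))"
    have "h \<in> holo_Omega"
      unfolding h_def by (intro diff_holo f sum_holo f_pq_holo)
    then have "openin sphere2_top ({y \<in> Omega. h y \<in> ball (h x) \<epsilon>} \<inter> U)"
      by (intro openin_Int holo_openin_preimage U(1) open_ball)
    moreover have "x \<in> {y \<in> Omega. h y \<in> ball (h x) \<epsilon>} \<inter> U" using x U(2) \<epsilon> by auto
    ultimately obtain z w where zw: "(Some z, Some w) \<in> {y \<in> Omega. h y \<in> ball (h x) \<epsilon>} \<inter> U"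
      by (rule finite_points_dense)
    let ?y = "(Some z, Some w)"
    have "f ?y = g ?y"
      using has_sum_unique[OF finite_expansion[OF f] g] zw by auto
    then have "norm (h ?y) < \<epsilon>"
      using I[of ?y] zw by (simp add: h_def dist_norm norm_minus_commute case_prod_unfold)
    moreover have "norm (h x - h ?y) < \<epsilon>"
      using zw by (simp add: dist_norm)
    moreover have "norm ((f x - h x) - g x) < \<epsilon>"
      using I[OF U(2)] by (simp add: h_def dist_norm case_prod_unfold)
    ultimately show ?thesis by norm
  qed
  then have "norm (f x - g x) \<le> 0 + \<delta>" if "\<delta> > 0" for \<delta>
    using that by (metis add_0 mult.commute nonzero_divide_eq_eq zero_less_divide_iff zero_less_numeral zero_neq_numeral)
  then have "norm (f x - g x) \<le> 0" by (rule field_le_epsilon)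
  with g[OF x] show ?thesis by simp
qed

section \<open>Uniqueness of the coefficients and the basis property\<close>

text \<open>At the point with both parameters equal to \<open>M\<close>, the first parametrisation turns \<open>f_pq p q\<close> into
  \<open>M ^ (p + q)\<close> for \<open>p \<le> q\<close>, and the second one does so for \<open>p \<ge> q\<close>. Convergence at these points for all
  \<open>M\<close> is therefore enough.\<close>

lemma pointwise_summable_imp_rapid:
  assumes "\<And>x. x \<in> Omega \<Longrightarrow> (\<lambda>(p, q). a p q * f_pq p q x) summable_on UNIV"
  shows "rapid a"
  unfolding rapid_def
proof (intro allI impI)
  fix M :: real assume M: "M > 0"
  define R where "R = complex_of_real M"
  have "(\<lambda>i. norm (case i of (p, q) \<Rightarrow> a p q * f_pq p q (chart_left R R))) summable_on UNIV"
    "(\<lambda>i. norm (case i of (p, q) \<Rightarrow> a p q * f_pq p q (chart_right R R))) summable_on UNIV"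
    using assms[OF chart_left_Omega[of R R]] assms[OF chart_right_Omega[of R R]]
    by (simp_all only: summable_on_iff_abs_summable_on_complex)
  from summable_on_add[OF this]
  show "(\<lambda>(p, q). norm (a p q) * M ^ (p + q)) summable_on UNIV"
  proof (rule summable_on_comparison_test)
    fix i :: "nat \<times> nat"
    obtain p q where i: "i = (p, q)" by (cases i)
    have "norm (a p q) * M ^ (p + q) = norm (a p q * (R ^ p * R ^ q))"
      using M by (simp add: R_def norm_mult norm_power power_add)
    also have "\<dots> \<le> norm (a p q * f_pq p q (chart_left R R)) + norm (a p q * f_pq p q (chart_right R R))"
      by (cases "p \<le> q") (auto simp: f_pq_chart_left f_pq_chart_right)
    finally show "(case i of (p, q) \<Rightarrow> norm (a p q) * M ^ (p + q)) \<le>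
      norm (case i of (p, q) \<Rightarrow> a p q * f_pq p q (chart_left R R)) +
      norm (case i of (p, q) \<Rightarrow> a p q * f_pq p q (chart_right R R))"
      by (simp add: i)
  qed (use M in auto)
qed

lemma limitin_holo_topI:
  assumes f: "f \<in> holo_Omega" and g: "\<And>n. g n \<in> holo_Omega"
    and lim: "\<And>K. compactin sphere2_top K \<Longrightarrow> K \<subseteq> Omega \<Longrightarrow> uniform_limit K g f F"
  shows "limitin holo_top g f F"
  unfolding limitin_def topspace_holo_top
proof (intro conjI allI impI f)
  fix U assume U: "openin holo_top U \<and> f \<in> U"
  then obtain K e where K: "compactin sphere2_top K" "K \<subseteq> Omega" "e > 0" "holo_nbhd f K e \<subseteq> U"
    unfolding openin_holo_top holo_open_def by blast
  from uniform_limitD[OF lim[OF K(1,2)] K(3)]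
  show "\<forall>\<^sub>F n in F. g n \<in> U"
  proof eventually_elim
    case (elim n)
    then have "g n \<in> holo_nbhd f K e" using g by (simp add: holo_nbhd_def dist_norm)
    with K(4) show ?case by blast
  qed
qed

lemma limitin_f_pq_series:
  assumes a: "rapid a" and f: "f \<in> holo_Omega"
    and sum: "\<And>x. x \<in> Omega \<Longrightarrow> ((\<lambda>(p, q). a p q * f_pq p q x) has_sum f x) UNIV"
  shows "limitin holo_top (\<lambda>F x. \<Sum>(p, q)\<in>F. a p q * f_pq p q x) f (finite_subsets_at_top UNIV)"
proof (rule limitin_holo_topI[OF f])
  show "(\<lambda>x. \<Sum>(p, q)\<in>I. a p q * f_pq p q x) \<in> holo_Omega" for I
    unfolding case_prod_unfold by (intro sum_holo f_pq_holo)
  fix K assume K: "compactin sphere2_top K" "K \<subseteq> Omega"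
  obtain M where "M > 0" "\<And>x p q. x \<in> K \<Longrightarrow> norm (f_pq p q x) \<le> M ^ (p + q)"
    using f_pq_bound_compact[OF K] by metis
  then show "uniform_limit K (\<lambda>F x. \<Sum>(p, q)\<in>F. a p q * f_pq p q x) f (finite_subsets_at_top UNIV)"
    using K(2) by (intro uniform_limit_f_pq_series[OF a _ _ sum]) auto
qed

lemma coeff_integral_partial_sum:
  assumes "finite I"
  shows "coeff_integral (\<lambda>x. \<Sum>(p, q)\<in>I. a p q * f_pq p q x) m n = (if (m, n) \<in> I then a m n else 0)"
proof -
  have "coeff_integral (\<lambda>x. \<Sum>(p, q)\<in>I. a p q * f_pq p q x) m n =
      (\<Sum>i\<in>I. a (fst i) (snd i) * coeff_integral (f_pq (fst i) (snd i)) m n)"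
    unfolding case_prod_unfold by (rule coeff_integral_sum[OF assms f_pq_holo])
  also have "\<dots> = (\<Sum>i\<in>I. if i = (m, n) then a m n else 0)"
    by (intro sum.cong refl) (auto simp: coeff_integral_f_pq prod_eq_iff)
  finally show ?thesis using assms by simp
qed

text \<open>Apply the continuous coefficient functional to the partial sums: by biorthogonality its value is
  eventually \<open>a m n\<close>. The index sets \<open>I\<close> are left open so as to cover both the unconditional sum and the
  initial segments of an enumeration.\<close>

lemma coeff_unique_of_limit:
  assumes lim: "limitin holo_top (\<lambda>k x. \<Sum>(p, q)\<in>I k. a p q * f_pq p q x) f F" and F: "F \<noteq> bot"
    and I: "filterlim I (finite_subsets_at_top UNIV) F"
  shows "a m n = coeff_integral f m n"
proof -
  have "((\<lambda>k. coeff_integral (\<lambda>x. \<Sum>(p, q)\<in>I k. a p q * f_pq p q x) m n) \<longlongrightarrow> coeff_integral f m n) F"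
    using continuous_map_limit[OF continuous_map_coeff_integral lim] by (simp add: o_def)
  moreover have "\<forall>\<^sub>F k in F. coeff_integral (\<lambda>x. \<Sum>(p, q)\<in>I k. a p q * f_pq p q x) m n = a m n"
  proof -
    have "\<forall>\<^sub>F k in F. finite (I k) \<and> {(m, n)} \<subseteq> I k \<and> I k \<subseteq> UNIV"
      using I unfolding filterlim_finite_subsets_at_top by blast
    then show ?thesis
      by eventually_elim (simp add: coeff_integral_partial_sum)
  qed
  ultimately have "((\<lambda>k. a m n) \<longlongrightarrow> coeff_integral f m n) F"
    by (rule Lim_transform_eventually)
  then show ?thesis using F by (simp add: tendsto_const_iff)
qed

lemma filterlim_bij_initial_segments:
  fixes \<sigma> :: "nat \<Rightarrow> 'a"
  assumes "bij \<sigma>"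
  shows "filterlim (\<lambda>N. \<sigma> ` {..<N}) (finite_subsets_at_top UNIV) sequentially"
  unfolding filterlim_finite_subsets_at_top
proof (intro allI impI)
  fix X :: "'a set" assume X: "finite X \<and> X \<subseteq> UNIV"
  then have "finite (inv \<sigma> ` X)" by simp
  then obtain k where k: "inv \<sigma> ` X \<subseteq> {..<k}" using finite_nat_iff_bounded by blast
  have sub: "X \<subseteq> \<sigma> ` {..<N}" if "N \<ge> k" for N
  proof
    fix x assume "x \<in> X"
    then have "inv \<sigma> x < N" using k that by force
    moreover have "\<sigma> (inv \<sigma> x) = x" using assms by (simp add: bij_is_surj surj_f_inv_f)
    ultimately show "x \<in> \<sigma> ` {..<N}" by (metis imageI lessThan_iff)
  qed
  show "\<forall>\<^sub>F N in sequentially. finite (\<sigma> ` {..<N}) \<and> X \<subseteq> \<sigma> ` {..<N} \<and> \<sigma> ` {..<N} \<subseteq> UNIV"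
    using eventually_ge_at_top[of k] by eventually_elim (use sub in auto)
qed

text \<open>An enumeration only selects a cofinal sequence of finite index sets, so convergence along it follows
  from unconditional convergence, while the continuous functionals determine the coefficients.\<close>

lemma expands_iff_coeff_integral:
  assumes \<sigma>: "bij \<sigma>" and f: "f \<in> holo_Omega"
  shows "expands holo_top (\<lambda>n. case \<sigma> n of (p, q) \<Rightarrow> f_pq p q) f b \<longleftrightarrow>
    b = (\<lambda>n. case \<sigma> n of (p, q) \<Rightarrow> coeff_integral f p q)"
proof -
  have inj: "inj \<sigma>" using \<sigma> by (rule bij_is_inj)
  note seg = filterlim_bij_initial_segments[OF \<sigma>]
  define a where "a = (\<lambda>p q. b (inv \<sigma> (p, q)))"
  have sum_eq: "(\<Sum>n<N. b n * (case \<sigma> n of (p, q) \<Rightarrow> f_pq p q) x) = (\<Sum>(p, q)\<in>\<sigma> ` {..<N}. a p q * f_pq p q x)" for N x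
    by (subst sum.reindex[OF inj_on_subset[OF inj]]) (simp_all add: a_def inv_f_f[OF inj] case_prod_unfold)
  have exp_iff: "expands holo_top (\<lambda>n. case \<sigma> n of (p, q) \<Rightarrow> f_pq p q) f b \<longleftrightarrow>
      limitin holo_top (\<lambda>N x. \<Sum>(p, q)\<in>\<sigma> ` {..<N}. a p q * f_pq p q x) f sequentially"
    by (simp add: expands_def sum_eq)
  show ?thesis
  proof
    assume "expands holo_top (\<lambda>n. case \<sigma> n of (p, q) \<Rightarrow> f_pq p q) f b"
    then have "a p q = coeff_integral f p q" for p q
      unfolding exp_iff by (rule coeff_unique_of_limit[OF _ _ seg]) simp
    moreover have "b n = (case \<sigma> n of (p, q) \<Rightarrow> a p q)" for n
      by (simp add: a_def inv_f_f[OF inj] case_prod_unfold)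
    ultimately show "b = (\<lambda>n. case \<sigma> n of (p, q) \<Rightarrow> coeff_integral f p q)" by auto
  next
    assume b: "b = (\<lambda>n. case \<sigma> n of (p, q) \<Rightarrow> coeff_integral f p q)"
    have "a = coeff_integral f"
      using \<sigma> by (auto simp: fun_eq_iff a_def b bij_is_surj surj_f_inv_f)
    then have "limitin holo_top (\<lambda>F x. \<Sum>(p, q)\<in>F. a p q * f_pq p q x) f (finite_subsets_at_top UNIV)"
      using limitin_f_pq_series[OF rapid_coeff_integral[OF f] f expansion[OF f]] by simp
    then show "expands holo_top (\<lambda>n. case \<sigma> n of (p, q) \<Rightarrow> f_pq p q) f b"
      unfolding exp_iff limitin_def using eventually_compose_filterlim[OF _ seg] by blast
  qed
qed

theorem corollary4p8:
  shows
    "(\<forall>\<sigma> :: nat \<Rightarrow> nat \<times> nat. bij \<sigma> \<longrightarrow>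
        schauder_basis holo_top (\<lambda>n. case \<sigma> n of (p, q) \<Rightarrow> f_pq p q) \<and>
        (\<forall>f\<in>holo_Omega. \<forall>n.
           schauder_coeff holo_top (\<lambda>n. case \<sigma> n of (p, q) \<Rightarrow> f_pq p q) f n =
           (case \<sigma> n of (p, q) \<Rightarrow> coeff_integral f p q))) \<and>
     (\<forall>f\<in>holo_Omega.
        (\<exists>!a :: nat \<Rightarrow> nat \<Rightarrow> complex.
           \<forall>x\<in>Omega. ((\<lambda>(p, q). a p q * f_pq p q x) has_sum f x) UNIV) \<and>
        (\<forall>a :: nat \<Rightarrow> nat \<Rightarrow> complex.
           (\<forall>x\<in>Omega. ((\<lambda>(p, q). a p q * f_pq p q x) has_sum f x) UNIV) \<longrightarrow>
           (\<forall>x\<in>Omega. (\<lambda>(p, q). cmod (a p q * f_pq p q x)) summable_on UNIV) \<and>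
           (\<forall>x\<in>Omega. \<exists>U. openin sphere2_top U \<and> x \<in> U \<and> U \<subseteq> Omega \<and>
              uniform_limit U (\<lambda>F y. \<Sum>(p, q)\<in>F. a p q * f_pq p q y) f
                (finite_subsets_at_top UNIV)) \<and>
           (\<forall>p q. a p q = coeff_integral f p q)))"
proof (intro conjI allI impI ballI)
  fix \<sigma> :: "nat \<Rightarrow> nat \<times> nat" assume \<sigma>: "bij \<sigma>"
  let ?e = "\<lambda>n. case \<sigma> n of (p, q) \<Rightarrow> f_pq p q"
  note iff = expands_iff_coeff_integral[OF \<sigma>]
  have coeff: "schauder_coeff holo_top ?e f n = (case \<sigma> n of (p, q) \<Rightarrow> coeff_integral f p q)"
    if "f \<in> holo_Omega" for f n
    by (simp add: schauder_coeff_def iff[OF that])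
  from this show "schauder_coeff holo_top ?e f n = (case \<sigma> n of (p, q) \<Rightarrow> coeff_integral f p q)"
    if "f \<in> holo_Omega" for f n
    using that .
  show "schauder_basis holo_top ?e"
    unfolding schauder_basis_def topspace_holo_top
  proof (intro conjI allI ballI)
    show "?e n \<in> holo_Omega" for n
      by (simp add: f_pq_holo case_prod_unfold)
    show "\<exists>!a. expands holo_top ?e f a" if "f \<in> holo_Omega" for f
      by (simp add: iff[OF that])
    show "continuous_map holo_top euclidean (\<lambda>f. schauder_coeff holo_top ?e f n)" for n
    proof (rule continuous_map_eq)
      show "continuous_map holo_top euclidean (\<lambda>f. coeff_integral f (fst (\<sigma> n)) (snd (\<sigma> n)))"
        by (rule continuous_map_coeff_integral)
      show "coeff_integral f (fst (\<sigma> n)) (snd (\<sigma> n)) = schauder_coeff holo_top ?e f n"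
        if "f \<in> topspace holo_top" for f
        using coeff[of f n] that by (simp add: topspace_holo_top case_prod_unfold)
    qed
  qed
next
  fix f assume f: "f \<in> holo_Omega"
  have *: "rapid a \<and> a = coeff_integral f"
    if a: "\<forall>x\<in>Omega. ((\<lambda>(p, q). a p q * f_pq p q x) has_sum f x) UNIV" for a
  proof
    show "rapid a"
      using a by (intro pointwise_summable_imp_rapid) (auto simp: summable_on_def)
    then have "limitin holo_top (\<lambda>F x. \<Sum>(p, q)\<in>F. a p q * f_pq p q x) f (finite_subsets_at_top UNIV)"
      using a by (intro limitin_f_pq_series f) auto
    then show "a = coeff_integral f"
      by (intro ext) (rule coeff_unique_of_limit, auto simp: filterlim_ident)
  qed
  show "\<exists>!a. \<forall>x\<in>Omega. ((\<lambda>(p, q). a p q * f_pq p q x) has_sum f x) UNIV"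
    using * expansion[OF f] by (intro ex1I[of _ "coeff_integral f"]) auto
  fix a :: "nat \<Rightarrow> nat \<Rightarrow> complex"
  assume a: "\<forall>x\<in>Omega. ((\<lambda>(p, q). a p q * f_pq p q x) has_sum f x) UNIV"
  note ra = *[OF a, THEN conjunct1]
  show "a p q = coeff_integral f p q" for p q using *[OF a] by simp
  fix x assume x: "x \<in> Omega"
  show "(\<lambda>(p, q). cmod (a p q * f_pq p q x)) summable_on UNIV"
    by (rule f_pq_series_abs_summable[OF ra x])
  obtain U M where U: "openin sphere2_top U" "x \<in> U" "U \<subseteq> Omega" "M > 0"
    "\<And>x p q. x \<in> U \<Longrightarrow> norm (f_pq p q x) \<le> M ^ (p + q)"
    using f_pq_bound_local[OF x] by metis
  have "uniform_limit U (\<lambda>F y. \<Sum>(p, q)\<in>F. a p q * f_pq p q y) f (finite_subsets_at_top UNIV)"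
    using U a by (intro uniform_limit_f_pq_series[OF ra U(4)]) auto
  with U show "\<exists>U. openin sphere2_top U \<and> x \<in> U \<and> U \<subseteq> Omega \<and>
      uniform_limit U (\<lambda>F y. \<Sum>(p, q)\<in>F. a p q * f_pq p q y) f (finite_subsets_at_top UNIV)"
    by blast
qed

end
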